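(* There exists a domain $D\subset\mathbb{C}$ whose Hardy number $h(D)$ and Bergman number $b(D)$ satisfy $0<h(D)<b(D)<+\infty$.
   Context: A domain is a nonempty connected open subset of $\mathbb{C}$. Let $\mathbb{D}$ be the open unit disk, and for a domain $D\subset\mathbb{C}$ let $\mathrm{Hol}(\mathbb{D},D)$ be the set of holomorphic functions $f:\mathbb{D}\to D$. For $0<p<\infty$, the Hardy space $H^p$ is the set of holomorphic $f$ on $\mathbb{D}$ with $\sup_{0<r<1}\int_0^{2\pi}|f(re^{i\theta})|^p\,d\theta<+\infty$. The Hardy number of $f\in\mathrm{Hol}(\mathbb{D},\mathbb{C})$ is $h(f):=\sup(\{p>0: f\in H^p\}\cup\{0\})\in[0,+\infty]$. The Hardy number of a domain $D$ is $h(D):=\sup(\{p>0:\mathrm{Hol}(\mathbb{D},D)\subset H^p\}\cup\{0\})=\inf\{h(f): f\in\mathrm{Hol}(\mathbb{D},D)\}\in[0,+\infty]$. For $p>0$ and $\alpha>-1$, the weighted Bergman space $A^p_\alpha$ is the set of holomorphic $f$ on $\mathbb{D}$ with $\int_{\mathbb{D}}|f(z)|^p(1-|z|)^\alpha\,dA(z)<+\infty$, where $dA$ is Lebesgue area measure. The Bergman number of a holomorphic function $f$ on $\mathbb{D}$ is $b(f):=\sup\left(\left\{\frac{p}{\alpha+2}: p>0,\ \alpha>-1,\ f\in A^p_\alpha\right\}\cup\{0\}\right)\in[0,+\infty]$. The Bergman number of a domain $D$ is $b(D):=\inf\{b(f): f\in\mathrm{Hol}(\mathbb{D},D)\}\in[0,+\infty]$.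 *)

theory Defs
  imports "HOL-Analysis.Analysis"
begin

definition complex_domain :: "complex set \<Rightarrow> bool" where
  "complex_domain D \<longleftrightarrow> D \<noteq> {} \<and> connected D \<and> open D"

abbreviation unit_disk :: "complex set" where
  "unit_disk \<equiv> ball 0 1"

text \<open>
  Functions on the disk are represented by total functions on the complex plane; their values
  outside the disk are arbitrary and irrelevant to every definition below.
\<close>

definition Hol :: "complex set \<Rightarrow> (complex \<Rightarrow> complex) set" where
  "Hol D = {f. f holomorphic_on unit_disk \<and> f ` unit_disk \<subseteq> D}"

text \<open>
  The integrals are Lebesgue integrals of nonnegative functions with values in the extended
  nonnegative reals, so a divergent integral has the value infinity (and not a default value).
\<close>

definition hardy_space :: "real \<Rightarrow> (complex \<Rightarrow> complex) set" where
  "hardy_space p = {f. f holomorphic_on unit_disk \<and>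
     (SUP r\<in>{0<..<1::real}. \<integral>\<^sup>+ \<theta>\<in>{0..2 * pi}.
        ennreal (cmod (f (of_real r * exp (\<i> * of_real \<theta>))) powr p) \<partial>lborel) < \<infinity>}"

definition hardy_number_domain :: "complex set \<Rightarrow> ereal" where
  "hardy_number_domain D = Sup ({ereal p | p. 0 < p \<and> Hol D \<subseteq> hardy_space p} \<union> {0})"

definition bergman_space :: "real \<Rightarrow> real \<Rightarrow> (complex \<Rightarrow> complex) set" where
  "bergman_space p \<alpha> = {f. f holomorphic_on unit_disk \<and>
     (\<integral>\<^sup>+ z\<in>unit_disk. ennreal (cmod (f z) powr p * (1 - cmod z) powr \<alpha>) \<partial>lborel) < \<infinity>}"

definition bergman_number :: "(complex \<Rightarrow> complex) \<Rightarrow> ereal" where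
  "bergman_number f =
     Sup ({ereal (p / (\<alpha> + 2)) | p \<alpha>. 0 < p \<and> -1 < \<alpha> \<and> f \<in> bergman_space p \<alpha>} \<union> {0})"

definition bergman_number_domain :: "complex set \<Rightarrow> ereal" where
  "bergman_number_domain D = Inf {bergman_number f | f. f \<in> Hol D}"

end

theory Submission
  imports Defs "HOL-Complex_Analysis.Complex_Analysis"
begin

text \<open>
  Let \<open>D\<close> be the right half-plane without the points \<open>2 ^ n\<close>, \<open>n \<in> \<int>\<close>. A discrete set of points is polar,
  so removing it does not affect the growth of harmonic majorants, and the Hardy number of \<open>D\<close> is at
  most 1, as for the half-plane. On the other hand the punctures increase the hyperbolic metric
  uniformly along the positive axis: a holomorphic \<open>F\<close> from the disc to \<open>D\<close> satisfies
  \<open>(1 - \<bar>z\<bar>\<^sup>2) \<bar>F' z\<bar> \<le> 2 \<kappa> \<bar>F z\<bar>\<close> with \<open>\<kappa> = 31/32\<close>, whence \<open>\<bar>F z\<bar> = O((1 - \<bar>z\<bar>) powr (- \<kappa>))\<close>. Such pointwise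
  bounds control the Bergman number, which is therefore larger than 1.

  For the Hardy number, suppose that all \<open>F\<close> lie in \<open>H\<^sup>p\<close> with \<open>p > 1\<close>, and let \<open>u w\<close> be the supremum of
  the \<open>p\<close>-th power means of all \<open>F\<close> with \<open>F 0 = w\<close>. Factoring through a map with the lifting property
  of the universal covering shows that \<open>u\<close> is superharmonic on \<open>D\<close>. Since \<open>\<bar>w\<bar> powr p \<le> u w\<close>, the minimum
  principle on \<open>{Re w > 1, \<bar>w\<bar> < R}\<close> gives \<open>u w \<ge> R powr (p - 1) * (Re w - 1)\<close> for every large \<open>R\<close>, which is
  absurd.
\<close>

section \<open>The disc and the half-plane\<close>

text \<open>Powers of 2 are chosen because consecutive punctures have a fixed ratio: at every scale,
  a point close to the positive axis has a puncture within a fixed hyperbolic distance, so a single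
  \<kappa> < 1 serves all points.

  Superharmonicity of \<open>u\<close> never appears as a mean value inequality. It is used in this
  form: for each \<open>w\<close> there are a holomorphic \<open>f\<close> with
  \<open>f 0 = w\<close> and a holomorphic \<open>K\<close> such that
  \<open>u (f z) \<le> Re (K z)\<close> on the disc and \<open>Re (K 0) \<le> u w\<close>. A minimum
  at \<open>w\<close> of \<open>u\<close> plus harmonic terms then becomes a minimum at 0 of the
  real part of a holomorphic function, and the maximum modulus principle applies. The inequality for
  all \<open>z\<close> requires every competitor based at \<open>f z\<close> to factor through
  \<open>f\<close>, from an arbitrary preimage of its base point; this is why the lifting property
  is demanded for all base points. Such an \<open>f\<close> comes from an extremal problem, dual to
  the maximal-derivative proof of the Riemann mapping theorem, so no covering surface has to be
  built.\<close>

definition halfplane :: "complex set" where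
  "halfplane = {w. 0 < Re w}"

text \<open>The Cayley transform normalised at the base point: for \<open>Re c > 0\<close> it maps
  the disc onto the half-plane with 0 going to \<open>c\<close>, and \<open>of_halfplane c\<close>
  is its inverse.\<close>

definition to_halfplane :: "complex \<Rightarrow> complex \<Rightarrow> complex" where
  "to_halfplane c z = (c + cnj c * z) / (1 - z)"

definition of_halfplane :: "complex \<Rightarrow> complex \<Rightarrow> complex" where
  "of_halfplane c w = (w - c) / (w + cnj c)"

text \<open>The lifting property of covering maps, for maps from the disc and an arbitrary base point.\<close>

definition lifts :: "(complex \<Rightarrow> complex) \<Rightarrow> complex set \<Rightarrow> bool" where
  "lifts f W \<longleftrightarrow> (\<forall>F\<in>Hol W. \<forall>\<zeta>\<in>unit_disk. f \<zeta> = F 0 \<longrightarrow>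
     (\<exists>G\<in>Hol unit_disk. G 0 = \<zeta> \<and> (\<forall>z\<in>unit_disk. f (G z) = F z)))"

lemma open_halfplane: "open halfplane"
  unfolding halfplane_def by (rule open_halfspace_Re_gt)

lemma convex_halfplane: "convex halfplane"
  unfolding halfplane_def by (rule convex_halfspace_Re_gt)

lemma HolI: "f holomorphic_on unit_disk \<Longrightarrow> (\<And>z. z \<in> unit_disk \<Longrightarrow> f z \<in> D) \<Longrightarrow> f \<in> Hol D"
  by (auto simp: Hol_def)

lemma Hol_holomorphic: "f \<in> Hol D \<Longrightarrow> f holomorphic_on unit_disk"
  by (simp add: Hol_def)

lemma Hol_in: "f \<in> Hol D \<Longrightarrow> z \<in> unit_disk \<Longrightarrow> f z \<in> D"
  by (auto simp: Hol_def)

lemma Hol_mono: "f \<in> Hol D \<Longrightarrow> D \<subseteq> E \<Longrightarrow> f \<in> Hol E"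
  by (auto simp: Hol_def)

lemma Hol_field_derivative:
  assumes "f \<in> Hol D" "z \<in> unit_disk"
  shows "(f has_field_derivative deriv f z) (at z)"
  using holomorphic_derivI[OF Hol_holomorphic[OF assms(1)] open_ball assms(2)] .

lemma Hol_compose:
  assumes "F \<in> Hol D" "G \<in> Hol unit_disk"
  shows "(\<lambda>z. F (G z)) \<in> Hol D"
proof (rule HolI)
  show "(\<lambda>z. F (G z)) holomorphic_on unit_disk"
    using holomorphic_on_compose_gen[of G unit_disk F unit_disk] assms
    by (auto simp: Hol_def o_def)
  show "F (G z) \<in> D" if "z \<in> unit_disk" for z
    by (rule Hol_in[OF assms(1) Hol_in[OF assms(2) that]])
qed

lemma Hol_compose_holomorphic:
  assumes "T holomorphic_on E" "F \<in> Hol E" "\<And>w. w \<in> E \<Longrightarrow> T w \<in> D"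
  shows "(\<lambda>z. T (F z)) \<in> Hol D"
proof (rule HolI)
  show "(\<lambda>z. T (F z)) holomorphic_on unit_disk"
    using holomorphic_on_compose_gen[of F unit_disk T E] assms
    by (auto simp: Hol_def o_def)
  show "T (F z) \<in> D" if "z \<in> unit_disk" for z
    by (rule assms(3)[OF Hol_in[OF assms(2) that]])
qed

lemma Re_to_halfplane:
  assumes "z \<noteq> 1"
  shows "Re (to_halfplane c z) = Re c * (1 - (cmod z)\<^sup>2) / (cmod (1 - z))\<^sup>2"
proof -
  have "Re (to_halfplane c z) = Re ((c + cnj c * z) * cnj (1 - z)) / (cmod (1 - z))\<^sup>2"
    unfolding to_halfplane_def by (subst complex_div_cnj) (simp flip: of_real_power)
  also have "Re ((c + cnj c * z) * cnj (1 - z)) = Re c * (1 - (cmod z)\<^sup>2)"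
    unfolding cmod_power2 by (simp add: algebra_simps power2_eq_square)
  finally show ?thesis .
qed

lemma to_halfplane_in:
  assumes "0 < Re c" "z \<in> unit_disk" shows "to_halfplane c z \<in> halfplane"
proof -
  have "z \<noteq> 1" "(cmod z)\<^sup>2 < 1"
    using assms by (auto simp: power_less_one_iff)
  thus ?thesis
    using assms by (simp add: halfplane_def Re_to_halfplane)
qed

lemma Hol_to_halfplane: "0 < Re c \<Longrightarrow> to_halfplane c \<in> Hol halfplane"
  by (intro HolI to_halfplane_in) (auto simp: to_halfplane_def[abs_def] intro!: holomorphic_intros)

lemma of_halfplane_in_ball:
  assumes "0 < Re c" "w \<in> halfplane" shows "of_halfplane c w \<in> unit_disk"
proof -
  have "(cmod (w + cnj c))\<^sup>2 - (cmod (w - c))\<^sup>2 = 4 * Re w * Re c"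
    unfolding cmod_power2 by (simp add: power2_eq_square algebra_simps)
  moreover have "0 < 4 * Re w * Re c" using assms by (simp add: halfplane_def)
  ultimately have "cmod (w - c) < cmod (w + cnj c)"
    by (rule_tac power2_less_imp_less) (linarith, rule norm_ge_zero)
  moreover from this have "0 < cmod (w + cnj c)" by (rule le_less_trans[OF norm_ge_zero])
  ultimately show ?thesis
    by (simp only: mem_ball_0 of_halfplane_def norm_divide divide_less_eq_1_pos)
qed

lemma of_halfplane_holomorphic: "0 < Re c \<Longrightarrow> of_halfplane c holomorphic_on halfplane"
  unfolding of_halfplane_def[abs_def]
  by (intro holomorphic_intros) (auto simp: halfplane_def complex_eq_iff)

lemma to_of_halfplane:
  assumes "0 < Re c" "w \<in> halfplane" shows "to_halfplane c (of_halfplane c w) = w"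
proof -
  have 1: "w + cnj c \<noteq> 0"
    using assms by (auto simp: halfplane_def complex_eq_iff)
  have 2: "c + cnj c \<noteq> 0"
    using assms by (auto simp: complex_eq_iff)
  have 3: "1 - of_halfplane c w = (c + cnj c) / (w + cnj c)"
    using 1 by (simp add: of_halfplane_def field_simps)
  have 4: "c + cnj c * of_halfplane c w = w * (c + cnj c) / (w + cnj c)"
    using 1 by (simp add: of_halfplane_def field_simps)
  show ?thesis
    unfolding to_halfplane_def 3 4 using 1 2 by simp
qed

lemma of_to_halfplane:
  assumes "0 < Re c" "z \<in> unit_disk" shows "of_halfplane c (to_halfplane c z) = z"
proof -
  have 1: "1 - z \<noteq> 0" using assms by auto
  have 2: "c + cnj c \<noteq> 0"
    using assms by (auto simp: complex_eq_iff)
  have 3: "to_halfplane c z - c = z * (c + cnj c) / (1 - z)"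
    "to_halfplane c z + cnj c = (c + cnj c) / (1 - z)"
    using 1 by (auto simp: to_halfplane_def field_simps)
  show ?thesis
    unfolding of_halfplane_def 3 using 1 2 by simp
qed

lemma of_halfplane_self: "of_halfplane c c = 0"
  by (simp add: of_halfplane_def)

lemma to_halfplane_0: "to_halfplane c 0 = c"
  by (simp add: to_halfplane_def)

text \<open>Following \<open>h\<close> by the Cayley transform centred at \<open>h 0\<close> gives a
  self-map of the disc that fixes 0, so both bounds are the Schwarz lemma. The growth bound later
  supplies the local boundedness in Montel's theorem.\<close>

lemma
  assumes h: "h \<in> Hol halfplane"
  shows Schwarz_Pick_halfplane: "cmod (deriv h 0) \<le> 2 * Re (h 0)"
    and halfplane_growth:
      "z \<in> unit_disk \<Longrightarrow> cmod (h z) \<le> cmod (h 0) * ((1 + cmod z) / (1 - cmod z))"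
proof -
  define c where "c = h 0"
  have c: "0 < Re c"
    using Hol_in[OF h, of 0] by (simp add: c_def halfplane_def)
  define g where "g = (\<lambda>z. of_halfplane c (h z))"
  have gH: "g \<in> Hol unit_disk"
    unfolding g_def
    by (rule Hol_compose_holomorphic[OF of_halfplane_holomorphic[OF c] h of_halfplane_in_ball[OF c]])
  have g0: "g 0 = 0" by (simp add: g_def c_def of_halfplane_self)
  have gb: "cmod (g z) < 1" if "cmod z < 1" for z
    using Hol_in[OF gH, of z] that by auto
  note S = Schwarz_Lemma[OF Hol_holomorphic[OF gH] g0 gb]
  have ne: "c + cnj c \<noteq> 0" using c by (auto simp: complex_eq_iff)
  have "((\<lambda>z. h z - c) has_field_derivative deriv h 0) (at 0)"
    "((\<lambda>z. h z + cnj c) has_field_derivative deriv h 0) (at 0)"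
    by (auto intro!: derivative_eq_intros Hol_field_derivative[OF h])
  from DERIV_divide[OF this] ne
  have "((\<lambda>z. (h z - c) / (h z + cnj c)) has_field_derivative
      (deriv h 0 * (c + cnj c) - (c - c) * deriv h 0) / ((c + cnj c) * (c + cnj c))) (at 0)"
    unfolding c_def by blast
  also have "(deriv h 0 * (c + cnj c) - (c - c) * deriv h 0) / ((c + cnj c) * (c + cnj c)) = deriv h 0 / (c + cnj c)"
    using ne by simp
  finally have "(g has_field_derivative deriv h 0 / (c + cnj c)) (at 0)"
    unfolding g_def of_halfplane_def .
  hence "deriv g 0 = deriv h 0 / (c + cnj c)" by (rule DERIV_imp_deriv)
  moreover have "c + cnj c = of_real (2 * Re c)" by (simp add: complex_add_cnj)
  ultimately have "cmod (deriv g 0) = cmod (deriv h 0) / (2 * Re c)"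
    using c by (simp add: norm_divide norm_mult)
  moreover have "cmod (deriv g 0) \<le> 1" by (rule S(2)[of 0]) auto
  ultimately show "cmod (deriv h 0) \<le> 2 * Re (h 0)"
    using c by (simp add: c_def divide_le_eq)
  assume z: "z \<in> unit_disk"
  have hz: "h z = to_halfplane c (g z)"
    unfolding g_def using to_of_halfplane[OF c Hol_in[OF h z]] by simp
  have gz: "cmod (g z) \<le> cmod z" "cmod z < 1"
    using S(1)[of z] z by auto
  have "cmod (h z) = cmod (c + cnj c * g z) / cmod (1 - g z)"
    by (simp add: hz to_halfplane_def norm_divide)
  also have "\<dots> \<le> (cmod c * (1 + cmod z)) / (1 - cmod z)"
  proof (rule frac_le)
    have "cmod (c + cnj c * g z) \<le> cmod c + cmod c * cmod (g z)"
      by (metis complex_mod_cnj norm_mult norm_triangle_ineq)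
    also have "\<dots> \<le> cmod c + cmod c * cmod z"
      using gz by (intro add_left_mono mult_left_mono) auto
    finally show "cmod (c + cnj c * g z) \<le> cmod c * (1 + cmod z)" by (simp add: algebra_simps)
    show "1 - cmod z \<le> cmod (1 - g z)"
      using gz norm_triangle_ineq2[of 1 "g z"] by simp
  qed (use gz in auto)
  finally show "cmod (h z) \<le> cmod (h 0) * ((1 + cmod z) / (1 - cmod z))"
    by (simp add: c_def)
qed

section \<open>Maps from the disc that omit a point of the disc\<close>

text \<open>The half-plane covers the punctured disc by \<open>exp (- w)\<close>, and a zero-free
  function on the disc has a global logarithm.\<close>

lemma punctured_disc_log:
  assumes "g \<in> Hol (unit_disk - {0})"
  obtains h where "h \<in> Hol halfplane" "\<And>z. z \<in> unit_disk \<Longrightarrow> g z = exp (- h z)"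
proof -
  have nz: "g z \<noteq> 0" if "z \<in> unit_disk" for z using Hol_in[OF assms that] by auto
  obtain k where k: "k holomorphic_on unit_disk" "\<And>z. z \<in> unit_disk \<Longrightarrow> exp (k z) = g z"
    by (rule holomorphic_logarithm_exists[OF convex_ball open_ball Hol_holomorphic[OF assms] nz, of 0 thesis])
       auto
  have "(\<lambda>z. - k z) \<in> Hol halfplane"
  proof (rule HolI)
    show "- k z \<in> halfplane" if "z \<in> unit_disk" for z
    proof -
      have "cmod (exp (k z)) < 1"
        using Hol_in[OF assms that] k(2)[OF that] by auto
      thus ?thesis by (simp add: halfplane_def)
    qed
  qed (use k in \<open>auto intro!: holomorphic_intros\<close>)
  thus ?thesis using k(2) by (intro that) auto
qed

text \<open>The Schwarz-Pick bound for the logarithm, pushed down by \<open>exp (- w)\<close>. This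
  is the punctured-disc substitute for the bound \<open>1 - |g 0|^2\<close> of the full disc, and
  the source of the gain from the punctures.\<close>

lemma punctured_disc_deriv_bound:
  assumes "g \<in> Hol (unit_disk - {0})"
  shows "cmod (deriv g 0) \<le> 2 * cmod (g 0) * ln (1 / cmod (g 0))"
proof -
  obtain h where h: "h \<in> Hol halfplane" "\<And>z. z \<in> unit_disk \<Longrightarrow> g z = exp (- h z)"
    by (rule punctured_disc_log[OF assms]) blast
  have "((\<lambda>z. exp (- h z)) has_field_derivative (- deriv h 0 * exp (- h 0))) (at 0)"
    by (auto intro!: derivative_eq_intros Hol_field_derivative[OF h(1)])
  hence "(g has_field_derivative (- deriv h 0 * exp (- h 0))) (at 0)"
    by (rule DERIV_cong_ev[THEN iffD1, rotated -1])
       (auto simp: h(2) intro!: eventually_nhds_in_open[of unit_disk, THEN eventually_mono])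
  hence "deriv g 0 = - deriv h 0 * exp (- h 0)" by (rule DERIV_imp_deriv)
  hence "cmod (deriv g 0) = cmod (deriv h 0) * cmod (g 0)"
    by (simp add: h(2) norm_mult)
  also have "\<dots> \<le> 2 * Re (h 0) * cmod (g 0)"
    by (intro mult_right_mono Schwarz_Pick_halfplane h) auto
  also have "Re (h 0) = ln (1 / cmod (g 0))"
    by (simp add: h(2) ln_div)
  finally show ?thesis by (simp add: mult_ac)
qed

text \<open>Taken with the sign that makes it its own inverse, so that one map serves both to move 0
  to \<open>a\<close> and to move \<open>a\<close> back.\<close>

lemma Moebius_involution:
  assumes "a \<in> unit_disk"
  obtains \<phi> where "\<phi> \<in> Hol unit_disk" "\<phi> 0 = a" "\<phi> a = 0"
    "\<And>z. z \<in> unit_disk \<Longrightarrow> \<phi> (\<phi> z) = z"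
    "(\<phi> has_field_derivative (- of_real (1 - (cmod a)\<^sup>2))) (at 0)"
proof -
  define \<phi> where "\<phi> = (\<lambda>z. (a - z) / (1 - cnj a * z))"
  have nz: "1 - cnj a * z \<noteq> 0" if "z \<in> unit_disk" for z
  proof
    assume "1 - cnj a * z = 0"
    hence "1 = cmod a * cmod z" by (metis complex_mod_cnj norm_mult norm_one right_minus_eq)
    moreover have "cmod a * cmod z < 1 * 1" using assms that by (intro mult_strict_mono) auto
    ultimately show False by simp
  qed
  have eq: "\<phi> = (\<lambda>z. - Moebius_function 0 a z)"
    unfolding \<phi>_def Moebius_function_simple by (intro ext) (metis minus_diff_eq minus_divide_left)
  have 1: "\<phi> \<in> Hol unit_disk"
    unfolding eq
    by (rule HolI) (use assms in \<open>auto intro!: holomorphic_intros Moebius_function_holomorphic Moebius_function_norm_lt_1\<close>)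
  have inv: "\<phi> (\<phi> z) = z" if "z \<in> unit_disk" for z
  proof -
    have n1: "1 - cnj a * z \<noteq> 0" "1 - cnj a * a \<noteq> 0" using nz that assms by auto
    have e1: "a - \<phi> z = z * (1 - cnj a * a) / (1 - cnj a * z)"
      "1 - cnj a * \<phi> z = (1 - cnj a * a) / (1 - cnj a * z)"
      using n1 by (auto simp: \<phi>_def field_simps)
    have "\<phi> (\<phi> z) = (a - \<phi> z) / (1 - cnj a * \<phi> z)" by (simp add: \<phi>_def)
    also have "\<dots> = z" unfolding e1 using n1 by simp
    finally show ?thesis .
  qed
  have "(\<phi> has_field_derivative (- 1 + a * cnj a)) (at 0)"
    unfolding \<phi>_def by (auto intro!: derivative_eq_intros)
  moreover have "- 1 + a * cnj a = - of_real (1 - (cmod a)\<^sup>2)"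
    by (simp flip: complex_norm_square)
  ultimately have "(\<phi> has_field_derivative (- of_real (1 - (cmod a)\<^sup>2))) (at 0)" by simp
  thus ?thesis using 1 inv by (intro that[of \<phi>]) (auto simp: \<phi>_def)
qed

text \<open>\<open>P\<close> is the universal covering of the disc without \<open>a\<close>: Cayley
  transform, then \<open>exp (- w)\<close> onto the punctured disc, then the involution taking 0 to
  \<open>a\<close>. Equality in the Schwarz lemma would make \<open>P\<close> a rotation, which
  attains \<open>a\<close>; hence the strict inequality.\<close>

lemma disc_minus_point_cover:
  assumes a: "a \<in> unit_disk" "a \<noteq> 0"
  obtains P where "P \<in> Hol (unit_disk - {a})" "P 0 = 0" "cmod (deriv P 0) < 1"
    "lifts P (unit_disk - {a})"
proof -
  obtain \<phi> where \<phi>: "\<phi> \<in> Hol unit_disk" "\<phi> 0 = a" "\<phi> a = 0"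
    "\<And>z. z \<in> unit_disk \<Longrightarrow> \<phi> (\<phi> z) = z"
    by (rule Moebius_involution[OF a(1)]) blast
  \<comment> \<open>Chosen so that \<open>Q 0 = exp (- c) = a\<close>, whence
    \<open>P 0 = \<phi> a = 0\<close>.\<close>
  define c where "c = - Ln a"
  have c: "0 < Re c" "exp (- c) = a" using a by (auto simp: c_def)
  define Q where "Q = (\<lambda>z. exp (- to_halfplane c z))"
  have Q: "Q \<in> Hol (unit_disk - {0})"
    unfolding Q_def
    by (rule Hol_compose_holomorphic[OF _ Hol_to_halfplane[OF c(1)]])
       (auto intro!: holomorphic_intros simp: halfplane_def)
  have Q1: "Q \<in> Hol unit_disk" by (rule Hol_mono[OF Q]) auto
  define P where "P = (\<lambda>z. \<phi> (Q z))"
  have PH: "P \<in> Hol unit_disk"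
    unfolding P_def by (rule Hol_compose[OF \<phi>(1) Q1])
  have Pa: "P z \<noteq> a" if "z \<in> unit_disk" for z
  proof
    assume "P z = a"
    hence "\<phi> (\<phi> (Q z)) = 0" by (simp add: P_def \<phi>(3))
    thus False using \<phi>(4)[OF Hol_in[OF Q1 that]] Hol_in[OF Q that] by auto
  qed
  have P: "P \<in> Hol (unit_disk - {a})"
    by (rule HolI) (use PH Pa Hol_in[OF PH] in \<open>auto simp: Hol_holomorphic\<close>)
  have P0: "P 0 = 0" by (simp add: P_def Q_def to_halfplane_0 c(2) \<phi>(3))
  have Pb: "cmod (P z) < 1" if "cmod z < 1" for z using Hol_in[OF PH, of z] that by auto
  note S = Schwarz_Lemma[OF Hol_holomorphic[OF PH] P0 Pb]
  have "cmod (deriv P 0) \<noteq> 1"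
  proof
    assume "cmod (deriv P 0) = 1"
    then obtain \<alpha> where \<alpha>: "\<And>z. norm z < 1 \<Longrightarrow> P z = \<alpha> * z" "norm \<alpha> = 1"
      using S(3)[of 0] by auto
    have "cmod (a / \<alpha>) < 1" using a \<alpha> by (simp add: norm_divide)
    moreover from this have "P (a / \<alpha>) = a" using \<alpha>(1)[of "a/\<alpha>"] \<alpha>(2) by auto
    ultimately show False using Pa[of "a / \<alpha>"] by auto
  qed
  hence P': "cmod (deriv P 0) < 1" using S(2)[of 0] by auto
  have "lifts P (unit_disk - {a})"
    unfolding lifts_def
  proof safe
    fix F \<zeta> assume F: "F \<in> Hol (unit_disk - {a})" and \<zeta>: "\<zeta> \<in> unit_disk" and eq: "P \<zeta> = F 0"
    have F1: "F \<in> Hol unit_disk" by (rule Hol_mono[OF F]) auto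
    have g1: "(\<lambda>z. \<phi> (F z)) \<in> Hol unit_disk" by (rule Hol_compose[OF \<phi>(1) F1])
    have "\<phi> (F z) \<noteq> 0" if "z \<in> unit_disk" for z
    proof
      assume "\<phi> (F z) = 0"
      hence "\<phi> (\<phi> (F z)) = a" by (simp add: \<phi>)
      thus False using \<phi>(4)[OF Hol_in[OF F1 that]] Hol_in[OF F that] by auto
    qed
    hence "(\<lambda>z. \<phi> (F z)) \<in> Hol (unit_disk - {0})"
      using g1 by (auto simp: Hol_def)
    then obtain h where h: "h \<in> Hol halfplane" "\<And>z. z \<in> unit_disk \<Longrightarrow> \<phi> (F z) = exp (- h z)"
      by (rule punctured_disc_log) blast
    have "exp (- h 0) = exp (- to_halfplane c \<zeta>)"
    proof -
      have "exp (- h 0) = \<phi> (F 0)" using h(2)[of 0] by simp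
      also have "\<dots> = \<phi> (\<phi> (Q \<zeta>))" by (simp add: eq[symmetric] P_def)
      also have "\<dots> = Q \<zeta>" by (rule \<phi>(4)[OF Hol_in[OF Q1 \<zeta>]])
      finally show ?thesis by (simp add: Q_def)
    qed
    hence one: "exp (h 0 - to_halfplane c \<zeta>) = 1"
      by (simp add: exp_diff exp_minus)
    hence re: "Re (h 0) = Re (to_halfplane c \<zeta>)"
      by (metis exp_eq_1 minus_complex.simps(1) eq_iff_diff_eq_0)
    \<comment> \<open>The logarithm \<open>h 0\<close> and the point over \<zeta> differ by a period
      of \<open>exp\<close>, which is imaginary. The shifted logarithm therefore stays in the
      half-plane and starts at the prescribed point.\<close>
    define k where "k = (\<lambda>z. h z - (h 0 - to_halfplane c \<zeta>))"
    have k: "k \<in> Hol halfplane"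
      by (rule HolI) (use Hol_in[OF h(1)] Hol_holomorphic[OF h(1)] re in \<open>auto simp: k_def halfplane_def intro!: holomorphic_intros\<close>)
    define G where "G = (\<lambda>z. of_halfplane c (k z))"
    have G: "G \<in> Hol unit_disk"
      unfolding G_def
      by (rule Hol_compose_holomorphic[OF of_halfplane_holomorphic[OF c(1)] k of_halfplane_in_ball[OF c(1)]])
    have "G 0 = \<zeta>" using \<zeta> c by (simp add: G_def k_def of_to_halfplane)
    moreover have "P (G z) = F z" if z: "z \<in> unit_disk" for z
    proof -
      have "to_halfplane c (G z) = k z"
        unfolding G_def by (rule to_of_halfplane[OF c(1) Hol_in[OF k z]])
      hence "Q (G z) = exp (- h z) * exp (h 0 - to_halfplane c \<zeta>)"
        unfolding exp_add[symmetric] by (simp add: Q_def k_def)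
      hence "Q (G z) = \<phi> (F z)" using one h(2)[OF z] by simp
      thus ?thesis unfolding P_def using \<phi>(4)[OF Hol_in[OF F1 z]] by simp
    qed
    ultimately show "\<exists>G\<in>Hol unit_disk. G 0 = \<zeta> \<and> (\<forall>z\<in>unit_disk. P (G z) = F z)"
      using G by auto
  qed
  with P P0 P' show ?thesis using that by blast
qed

section \<open>Existence of maps with the lifting property\<close>

text \<open>Locally uniform limits of self-maps of the disc are only known to lie in the closed
  disc; the maximum modulus principle excludes the boundary once one value is interior.\<close>

lemma disc_valued_limit:
  assumes "g holomorphic_on unit_disk" "\<And>z. z \<in> unit_disk \<Longrightarrow> cmod (g z) \<le> 1" "cmod (g 0) < 1"
  shows "g \<in> Hol unit_disk"
proof (rule HolI)
  fix z assume z: "z \<in> unit_disk"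
  show "g z \<in> unit_disk"
  proof (rule ccontr)
    assume "g z \<notin> unit_disk"
    hence gz: "cmod (g z) = 1" using assms(2)[OF z] by auto
    have "g constant_on unit_disk"
      by (rule maximum_modulus_principle[OF assms(1) open_ball connected_ball open_ball order_refl z])
         (use assms(2) in \<open>simp add: gz\<close>)
    then obtain c where "\<And>z. z \<in> unit_disk \<Longrightarrow> g z = c" unfolding constant_on_def by blast
    from this[OF z] this[of 0] show False using gz assms(3) by simp
  qed
qed (fact assms(1))

lemma Montel_disc:
  assumes "\<And>n::nat. f n \<in> Hol unit_disk"
  obtains g r where "g holomorphic_on unit_disk" "strict_mono (r :: nat \<Rightarrow> nat)"
    "\<And>z. z \<in> unit_disk \<Longrightarrow> (\<lambda>n. f (r n) z) \<longlonglongrightarrow> g z"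
    "\<And>K. compact K \<Longrightarrow> K \<subseteq> unit_disk \<Longrightarrow> uniform_limit K (\<lambda>n. f (r n)) g sequentially"
    "\<And>z. z \<in> unit_disk \<Longrightarrow> cmod (g z) \<le> 1"
proof -
  have bd: "\<exists>B. \<forall>h\<in>Hol unit_disk. \<forall>z\<in>K. cmod (h z) \<le> B" if K: "K \<subseteq> unit_disk" for K
  proof (intro exI[of _ 1] ballI)
    fix h z assume "h \<in> Hol unit_disk" "z \<in> K"
    hence "h z \<in> unit_disk" using Hol_in[of h unit_disk z] K by blast
    thus "cmod (h z) \<le> 1" by simp
  qed
  have rng: "range f \<subseteq> Hol unit_disk" using assms by blast
  show ?thesis
  proof (rule Montel[OF open_ball _ _ rng])
    show "h holomorphic_on unit_disk" if "h \<in> Hol unit_disk" for h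
      by (rule Hol_holomorphic[OF that])
    fix g r
    assume g: "g holomorphic_on unit_disk" and r: "strict_mono (r :: nat \<Rightarrow> nat)"
      and lim: "\<And>z. z \<in> unit_disk \<Longrightarrow> (\<lambda>n. f (r n) z) \<longlonglongrightarrow> g z"
      and ul: "\<And>K. compact K \<Longrightarrow> K \<subseteq> unit_disk \<Longrightarrow> uniform_limit K (f \<circ> r) g sequentially"
    have "cmod (g z) \<le> 1" if z: "z \<in> unit_disk" for z
    proof (rule Lim_norm_ubound[OF _ lim[OF z]])
      show "\<forall>\<^sub>F n in sequentially. cmod (f (r n) z) \<le> 1"
        using Hol_in[OF assms z] by (intro always_eventually allI) (simp add: less_imp_le)
    qed auto
    from that[OF g r lim ul[unfolded o_def] this] show ?thesis .
  qed (rule bd)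
qed

lemma Hol_unit_disk_deriv_le_1:
  assumes "G \<in> Hol unit_disk" "G 0 = 0"
  shows "cmod (deriv G 0) \<le> 1"
proof -
  have "cmod (G z) < 1" if "cmod z < 1" for z using Hol_in[OF assms(1), of z] that by simp
  from Schwarz_Lemma(2)[OF Hol_holomorphic[OF assms(1)] assms(2) this, of 0] show ?thesis by simp
qed

lemma tendsto_uniform_compose:
  fixes f :: "nat \<Rightarrow> complex \<Rightarrow> complex"
  assumes "uniform_limit K f g sequentially" "continuous (at w within K) g"
    and "x \<longlonglongrightarrow> w" "\<forall>\<^sub>F n in sequentially. x n \<in> K" "w \<in> K"
  shows "(\<lambda>n. f n (x n)) \<longlonglongrightarrow> g w"
proof -
  have "(\<lambda>n. g (x n)) \<longlonglongrightarrow> g w"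
    using assms(2-5) continuous_within_tendsto_compose by blast
  moreover have "(\<lambda>n. f n (x n) - g (x n)) \<longlonglongrightarrow> 0"
  proof (rule tendstoI)
    fix e :: real assume "e > 0"
    hence "\<forall>\<^sub>F n in sequentially. \<forall>y\<in>K. dist (f n y) (g y) < e"
      using assms(1) by (auto simp: uniform_limit_iff)
    with assms(4) show "\<forall>\<^sub>F n in sequentially. dist (f n (x n) - g (x n)) 0 < e"
      by eventually_elim (auto simp: dist_norm)
  qed
  ultimately show ?thesis using tendsto_add by fastforce
qed

text \<open>Otherwise \<open>f n - g \<zeta>\<close> would be zero-free near \<zeta> along a
  subsequence, and by Hurwitz its limit would be too, although it vanishes at \<zeta>. By the
  identity theorem, nonconstancy on the disc passes to the small set \<open>S\<close>.\<close>

lemma Hurwitz_solutions: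
  fixes f :: "nat \<Rightarrow> complex \<Rightarrow> complex"
  assumes f: "\<And>n. f n holomorphic_on unit_disk" and g: "g holomorphic_on unit_disk"
    and ul: "\<And>K. compact K \<Longrightarrow> K \<subseteq> unit_disk \<Longrightarrow> uniform_limit K f g sequentially"
    and nc: "\<not> g constant_on unit_disk" and \<zeta>: "\<zeta> \<in> unit_disk" and e: "e > 0"
  shows "\<forall>\<^sub>F n in sequentially. \<exists>z\<in>ball \<zeta> e \<inter> unit_disk. f n z = g \<zeta>"
proof (rule ccontr)
  define S where "S = ball \<zeta> e \<inter> unit_disk"
  assume "\<not> ?thesis"
  hence "infinite {n. \<forall>z\<in>S. f n z \<noteq> g \<zeta>}"
    unfolding eventually_sequentially S_def infinite_nat_iff_unbounded_le by blast
  then obtain s :: "nat \<Rightarrow> nat" where s: "strict_mono s" "\<And>n. s n \<in> {n. \<forall>z\<in>S. f n z \<noteq> g \<zeta>}"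
    using infinite_enumerate by blast
  have S: "open S" "connected S" "S \<subseteq> unit_disk" "\<zeta> \<in> S"
    using \<zeta> e unfolding S_def by (auto intro!: convex_connected convex_Int)
  have "g \<zeta> - g \<zeta> \<noteq> 0"
  proof (rule Hurwitz_no_zeros[of S "\<lambda>n z. f (s n) z - g \<zeta>" "\<lambda>z. g z - g \<zeta>"])
    show "(\<lambda>z. f (s n) z - g \<zeta>) holomorphic_on S" for n
      by (intro holomorphic_on_diff holomorphic_on_const holomorphic_on_subset[OF f S(3)])
    show "(\<lambda>z. g z - g \<zeta>) holomorphic_on S"
      by (intro holomorphic_on_diff holomorphic_on_const holomorphic_on_subset[OF g S(3)])
    show "uniform_limit K (\<lambda>n z. f (s n) z - g \<zeta>) (\<lambda>z. g z - g \<zeta>) sequentially"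
      if "compact K" "K \<subseteq> S" for K
    proof (rule uniform_limit_minus)
      have "uniform_limit K f g sequentially" using that S(3) by (intro ul) blast+
      from filterlim_compose[OF this filterlim_subseq[OF s(1)]]
      show "uniform_limit K (\<lambda>n. f (s n)) g sequentially" .
    qed (rule uniform_limit_const)
    show "\<not> (\<lambda>z. g z - g \<zeta>) constant_on S"
    proof
      assume "(\<lambda>z. g z - g \<zeta>) constant_on S"
      then obtain c where c: "\<And>z. z \<in> S \<Longrightarrow> g z - g \<zeta> = c" unfolding constant_on_def by blast
      have c': "g z = c + g \<zeta>" if "z \<in> S" for z using c[OF that] by (simp add: diff_eq_eq)
      have "S \<noteq> {}" using S(4) by blast
      from analytic_continuation_open[OF S(1) open_ball this connected_ball S(3) g holomorphic_on_const c']
      have "\<And>z. z \<in> unit_disk \<Longrightarrow> g z = c + g \<zeta>" .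
      thus False using nc unfolding constant_on_def by blast
    qed
  qed (use S s in auto)
  thus False by simp
qed

text \<open>A lift through \<open>f n\<close> must start at an exact preimage of \<open>F 0\<close>
  under \<open>f n\<close>, and \<zeta> is one only for the limit \<open>g\<close>. Hurwitz provides
  such preimages converging to \<zeta>; the lifts from them form a normal family, and a limit of
  them is the lift through \<open>g\<close>.\<close>

lemma lifts_limit:
  fixes f :: "nat \<Rightarrow> complex \<Rightarrow> complex"
  assumes f: "\<And>n. f n holomorphic_on unit_disk" "\<And>n. lifts (f n) W"
    and g: "g holomorphic_on unit_disk"
    and ul: "\<And>K. compact K \<Longrightarrow> K \<subseteq> unit_disk \<Longrightarrow> uniform_limit K f g sequentially"
    and nc: "\<not> g constant_on unit_disk"
  shows "lifts g W"
  unfolding lifts_def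
proof safe
  fix F \<zeta> assume F: "F \<in> Hol W" and \<zeta>: "\<zeta> \<in> unit_disk" and eq: "g \<zeta> = F 0"
  have "\<exists>n\<ge>k. \<exists>z\<in>ball \<zeta> (1 / (real k + 1)) \<inter> unit_disk. f n z = F 0" for k :: nat
  proof -
    have "\<forall>\<^sub>F n in sequentially. \<exists>z\<in>ball \<zeta> (1 / (real k + 1)) \<inter> unit_disk. f n z = g \<zeta>"
      by (rule Hurwitz_solutions[OF f(1) g ul nc \<zeta>]) auto
    then obtain N where "\<And>n. n \<ge> N \<Longrightarrow> \<exists>z\<in>ball \<zeta> (1 / (real k + 1)) \<inter> unit_disk. f n z = g \<zeta>"
      unfolding eventually_sequentially by blast
    thus ?thesis using eq by (intro exI[of _ "max k N"]) auto
  qed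
  then obtain \<nu> y where \<nu>: "\<And>k. \<nu> k \<ge> k"
    and y: "\<And>k::nat. y k \<in> ball \<zeta> (1 / (real k + 1)) \<inter> unit_disk" "\<And>k. f (\<nu> k) (y k) = F 0"
    by metis
  have "\<exists>G\<in>Hol unit_disk. G 0 = y k \<and> (\<forall>z\<in>unit_disk. f (\<nu> k) (G z) = F z)" for k
    using f(2)[of "\<nu> k"] F y[of k] unfolding lifts_def by blast
  then obtain G where G: "\<And>k. G k \<in> Hol unit_disk" "\<And>k. G k 0 = y k"
    "\<And>k z. z \<in> unit_disk \<Longrightarrow> f (\<nu> k) (G k z) = F z"
    by metis
  obtain H r where H: "H holomorphic_on unit_disk" "strict_mono (r :: nat \<Rightarrow> nat)"
    "\<And>z. z \<in> unit_disk \<Longrightarrow> (\<lambda>n. G (r n) z) \<longlonglongrightarrow> H z" "\<And>z. z \<in> unit_disk \<Longrightarrow> cmod (H z) \<le> 1"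
    by (rule Montel_disc[of G, OF G(1)]) blast
  have "(\<lambda>k. y k - \<zeta>) \<longlonglongrightarrow> 0"
  proof (rule Lim_null_comparison[OF always_eventually LIMSEQ_inverse_real_of_nat], rule allI)
    show "cmod (y k - \<zeta>) \<le> inverse (real (Suc k))" for k
      using y(1)[of k] by (simp add: dist_norm norm_minus_commute field_simps)
  qed
  hence "y \<longlonglongrightarrow> \<zeta>" by (simp add: LIM_zero_iff)
  hence "(\<lambda>n. G (r n) 0) \<longlonglongrightarrow> \<zeta>"
    using LIMSEQ_subseq_LIMSEQ[OF _ H(2)] by (fastforce simp: G(2) o_def)
  hence H0: "H 0 = \<zeta>" using H(3)[of 0] LIMSEQ_unique by auto
  have HH: "H \<in> Hol unit_disk" by (rule disc_valued_limit) (use H H0 \<zeta> in auto)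
  have "g (H z) = F z" if z: "z \<in> unit_disk" for z
  proof -
    obtain d where d: "d > 0" "cball (H z) d \<subseteq> unit_disk"
      using open_contains_cball[THEN iffD1, OF open_ball] Hol_in[OF HH z] by blast
    \<comment> \<open>The indices \<nu> need not be monotone; that they tend to infinity is enough
      to pass to them in the uniform limit.\<close>
    have "filterlim (\<lambda>n. \<nu> (r n)) sequentially sequentially"
      by (rule filterlim_at_top_mono[OF filterlim_ident])
         (use \<nu> seq_suble[OF H(2)] in \<open>auto intro!: always_eventually intro: order_trans\<close>)
    from filterlim_compose[OF ul[OF compact_cball d(2)] this]
    have ul': "uniform_limit (cball (H z) d) (\<lambda>n. f (\<nu> (r n))) g sequentially" .
    have "(\<lambda>n. f (\<nu> (r n)) (G (r n) z)) \<longlonglongrightarrow> g (H z)"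
    proof (rule tendsto_uniform_compose[OF ul' _ H(3)[OF z]])
      show "continuous (at (H z) within cball (H z) d) g"
        using holomorphic_on_imp_continuous_on[OF holomorphic_on_subset[OF g d(2)]] d(1)
        by (simp add: continuous_on_eq_continuous_within)
      show "\<forall>\<^sub>F n in sequentially. G (r n) z \<in> cball (H z) d"
        using tendstoD[OF H(3)[OF z] d(1)] by eventually_elim (simp add: dist_commute)
    qed (use d in auto)
    thus ?thesis by (simp add: G(3)[OF z] LIMSEQ_const_iff)
  qed
  with HH H0 show "\<exists>G\<in>Hol unit_disk. G 0 = \<zeta> \<and> (\<forall>z\<in>unit_disk. g (G z) = F z)" by blast
qed

lemma deriv_compose_at_0:
  assumes "f holomorphic_on unit_disk" "G \<in> Hol unit_disk"
  shows "((\<lambda>z. f (G z)) has_field_derivative deriv f (G 0) * deriv G 0) (at 0)"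
proof -
  have "G 0 \<in> unit_disk" using Hol_in[OF assms(2), of 0] by simp
  hence "(f has_field_derivative deriv f (G 0)) (at (G 0))"
    by (rule holomorphic_derivI[OF assms(1) open_ball])
  from DERIV_chain2[OF this Hol_field_derivative[OF assms(2)]] show ?thesis by simp
qed

text \<open>Lift first through \<open>f\<close>. The lift avoids \<open>a\<close>, since
  \<open>f a\<close> is not in \<open>W\<close>, so it can be lifted once more through
  \<open>P\<close>.\<close>

lemma lifts_compose:
  assumes f: "f \<in> Hol V" "lifts f W" and a: "a \<in> unit_disk" "f a \<notin> W"
    and P: "P \<in> Hol (unit_disk - {a})" "lifts P (unit_disk - {a})"
  shows "lifts (\<lambda>z. f (P z)) W"
  unfolding lifts_def
proof safe
  fix F \<zeta> assume F: "F \<in> Hol W" and \<zeta>: "\<zeta> \<in> unit_disk" and eq: "f (P \<zeta>) = F 0"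
  have "P \<zeta> \<in> unit_disk" using Hol_in[OF P(1) \<zeta>] by simp
  then obtain G where G: "G \<in> Hol unit_disk" "G 0 = P \<zeta>" "\<And>z. z \<in> unit_disk \<Longrightarrow> f (G z) = F z"
    using f(2) F eq unfolding lifts_def by blast
  have "G z \<noteq> a" if "z \<in> unit_disk" for z
    using a(2) G(3)[OF that] Hol_in[OF F that] by auto
  hence "G \<in> Hol (unit_disk - {a})"
    using Hol_in[OF G(1)] by (intro HolI Hol_holomorphic[OF G(1)]) blast
  from bspec[OF bspec[OF P(2)[unfolded lifts_def] this] \<zeta>] G(2)
  obtain K where K: "K \<in> Hol unit_disk" "K 0 = \<zeta>" "\<And>z. z \<in> unit_disk \<Longrightarrow> P (K z) = G z"
    by auto
  thus "\<exists>G\<in>Hol unit_disk. G 0 = \<zeta> \<and> (\<forall>z\<in>unit_disk. f (P (G z)) = F z)"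
    using G(3) by auto
qed

text \<open>The affine map of the disc onto \<open>ball b r\<close> lifts to a self-map of the disc
  fixing 0, to which the Schwarz lemma applies. This keeps a minimising sequence from degenerating
  to a constant.\<close>

lemma lifts_deriv_lower_bound:
  assumes f: "f holomorphic_on unit_disk" "lifts f W" "f 0 = b" and r: "r > 0" "ball b r \<subseteq> W"
  shows "r \<le> cmod (deriv f 0)"
proof -
  have lin: "(\<lambda>z. b + of_real r * z) \<in> Hol W"
  proof (rule HolI)
    fix z :: complex assume "z \<in> unit_disk"
    hence "b + of_real r * z \<in> ball b r" using r(1) by (simp add: dist_norm norm_mult)
    thus "b + of_real r * z \<in> W" using r(2) by blast
  qed (auto intro!: holomorphic_intros)
  have "\<exists>G\<in>Hol unit_disk. G 0 = 0 \<and> (\<forall>z\<in>unit_disk. f (G z) = b + of_real r * z)"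
    using bspec[OF bspec[OF f(2)[unfolded lifts_def] lin], of 0] f(3) by simp
  then obtain G where G: "G \<in> Hol unit_disk" "G 0 = 0"
    "\<And>z. z \<in> unit_disk \<Longrightarrow> f (G z) = b + of_real r * z" by blast
  have "((\<lambda>z. f (G z)) has_field_derivative deriv f 0 * deriv G 0) (at 0)"
    using deriv_compose_at_0[OF f(1) G(1)] by (simp add: G(2))
  moreover have "((\<lambda>z. f (G z)) has_field_derivative of_real r) (at 0)"
  proof (rule has_field_derivative_transform_within_open[of "\<lambda>z. b + of_real r * z" _ _ unit_disk])
    show "((\<lambda>z. b + of_real r * z) has_field_derivative of_real r) (at 0)"
      by (auto intro!: derivative_eq_intros)
  qed (auto simp: G(3))
  ultimately have "deriv f 0 * deriv G 0 = of_real r" by (rule DERIV_unique)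
  hence "r = cmod (deriv f 0) * cmod (deriv G 0)"
    using r(1) by (metis abs_of_pos norm_mult norm_of_real)
  also have "\<dots> \<le> cmod (deriv f 0) * 1"
    using Hol_unit_disk_deriv_le_1[OF G(1,2)] by (intro mult_left_mono) auto
  finally show ?thesis by simp
qed

text \<open>Minimise \<open>\<bar>f' 0\<bar>\<close> over the maps \<open>f\<close> into the whole disc that have the lifting property for \<open>W\<close>. If a
  minimiser took a value outside \<open>W\<close>, at \<open>a\<close> say, composing it with the covering of the disc without \<open>a\<close>
  would decrease the derivative.\<close>

lemma ex_lifting_map_disc:
  assumes W: "open W" "W \<subseteq> unit_disk" "b \<in> W"
  obtains f where "f \<in> Hol W" "f 0 = b" "deriv f 0 \<noteq> 0" "lifts f W"
proof -
  define \<F> where "\<F> = {f \<in> Hol unit_disk. f 0 = b \<and> lifts f W}"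
  obtain \<rho> where \<rho>: "\<rho> > 0" "ball b \<rho> \<subseteq> W" using W open_contains_ball by blast
  have lower: "\<rho> \<le> cmod (deriv f 0)" if "f \<in> \<F>" for f
    using that lifts_deriv_lower_bound[OF Hol_holomorphic _ _ \<rho>] by (auto simp: \<F>_def)
  have b: "b \<in> unit_disk" using W by blast
  obtain \<phi> where \<phi>: "\<phi> \<in> Hol unit_disk" "\<phi> 0 = b" "\<And>z. z \<in> unit_disk \<Longrightarrow> \<phi> (\<phi> z) = z"
    by (rule Moebius_involution[OF b]) blast
  \<comment> \<open>An automorphism of the disc lifts every map into the disc by composition with
    its inverse, so the family is nonempty.\<close>
  have "lifts \<phi> W"
    unfolding lifts_def
  proof safe
    fix F \<zeta> assume F: "F \<in> Hol W" and \<zeta>: "\<zeta> \<in> unit_disk" and eq: "\<phi> \<zeta> = F 0"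
    have F1: "F \<in> Hol unit_disk" by (rule Hol_mono[OF F W(2)])
    show "\<exists>G\<in>Hol unit_disk. G 0 = \<zeta> \<and> (\<forall>z\<in>unit_disk. \<phi> (G z) = F z)"
      using Hol_compose[OF \<phi>(1) F1] \<phi>(3)[OF \<zeta>] \<phi>(3)[OF Hol_in[OF F1]] eq
      by (intro bexI[of _ "\<lambda>z. \<phi> (F z)"]) auto
  qed
  hence ne: "\<phi> \<in> \<F>" using \<phi> by (simp add: \<F>_def)
  define m where "m = Inf ((\<lambda>f. cmod (deriv f 0)) ` \<F>)"
  have bdd: "bdd_below ((\<lambda>f. cmod (deriv f 0)) ` \<F>)" by (intro bdd_belowI2[of _ 0]) auto
  have m_le: "m \<le> cmod (deriv f 0)" if "f \<in> \<F>" for f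
    unfolding m_def by (rule cINF_lower[OF bdd that])
  have "\<exists>f\<in>\<F>. cmod (deriv f 0) < m + 1 / (real n + 1)" for n :: nat
    using cInf_lessD[of "(\<lambda>f. cmod (deriv f 0)) ` \<F>" "m + 1 / (real n + 1)"] ne
    unfolding m_def[symmetric] by auto
  then obtain s where s: "\<And>n. s n \<in> \<F>" "\<And>n::nat. cmod (deriv (s n) 0) < m + 1 / (real n + 1)" by metis
  have sH: "s n \<in> Hol unit_disk" "s n 0 = b" "lifts (s n) W" for n using s(1)[of n] by (auto simp: \<F>_def)
  obtain f r where f: "f holomorphic_on unit_disk" "strict_mono (r :: nat \<Rightarrow> nat)"
    "\<And>z. z \<in> unit_disk \<Longrightarrow> (\<lambda>n. s (r n) z) \<longlonglongrightarrow> f z"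
    "\<And>K. compact K \<Longrightarrow> K \<subseteq> unit_disk \<Longrightarrow> uniform_limit K (\<lambda>n. s (r n)) f sequentially"
    "\<And>z. z \<in> unit_disk \<Longrightarrow> cmod (f z) \<le> 1"
    by (rule Montel_disc[of s, OF sH(1)]) blast
  have f0: "f 0 = b" using f(3)[of 0] by (simp add: sH(2) LIMSEQ_const_iff)
  have fH: "f \<in> Hol unit_disk" by (rule disc_valued_limit) (use f f0 b in auto)
  have "(\<lambda>n. deriv (s (r n)) 0) \<longlonglongrightarrow> deriv f 0"
  proof (rule deriv_complex_uniform_limit)
    show "uniform_limit (ball 0 (1/2)) (\<lambda>n. s (r n)) f sequentially"
      by (rule uniform_limit_on_subset[OF f(4)[OF compact_cball[of 0 "1/2"]]]) auto
    show "\<forall>\<^sub>F n in sequentially. s (r n) holomorphic_on ball 0 (1/2)"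
      by (intro always_eventually allI holomorphic_on_subset[OF Hol_holomorphic[OF sH(1)]]) auto
  qed auto
  hence lim: "(\<lambda>n. cmod (deriv (s (r n)) 0)) \<longlonglongrightarrow> cmod (deriv f 0)" by (rule tendsto_norm)
  have "(\<lambda>n. m + inverse (real (Suc n))) \<longlonglongrightarrow> m + 0"
    by (intro tendsto_intros LIMSEQ_inverse_real_of_nat)
  from LIMSEQ_subseq_LIMSEQ[OF this f(2)]
  have "(\<lambda>n. m + inverse (real (Suc (r n)))) \<longlonglongrightarrow> m"
    by (simp add: o_def)
  moreover have "cmod (deriv (s (r n)) 0) \<le> m + inverse (real (Suc (r n)))" for n
    using s(2)[of "r n"] by (simp add: inverse_eq_divide add.commute)
  ultimately have up: "cmod (deriv f 0) \<le> m"
    by (intro LIMSEQ_le[OF lim]) auto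
  \<comment> \<open>The uniform lower bound survives the limit and makes \<open>f\<close>
    nonconstant, as passing the lifting property to the limit requires.\<close>
  have low: "\<rho> \<le> cmod (deriv f 0)"
  proof (rule tendsto_lowerbound[OF lim])
    show "\<forall>\<^sub>F n in sequentially. \<rho> \<le> cmod (deriv (s (r n)) 0)"
      using lower[OF s(1)] by (intro always_eventually) auto
  qed auto
  hence d0: "deriv f 0 \<noteq> 0" using \<rho>(1) by auto
  have "\<not> f constant_on unit_disk"
    using holomorphic_nonconstant[OF f(1) open_ball _ d0] by auto
  from lifts_limit[OF Hol_holomorphic[OF sH(1)] sH(3) f(1) f(4) this]
  have fl: "lifts f W" .
  have "f a \<in> W" if a: "a \<in> unit_disk" for a
  proof (rule ccontr)
    assume fa: "f a \<notin> W"
    hence "a \<noteq> 0" using f0 W(3) by auto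
    then obtain P where P: "P \<in> Hol (unit_disk - {a})" "P 0 = 0" "cmod (deriv P 0) < 1"
      "lifts P (unit_disk - {a})"
      using disc_minus_point_cover[OF a] by blast
    have PH: "P \<in> Hol unit_disk" by (rule Hol_mono[OF P(1)]) auto
    have "(\<lambda>z. f (P z)) \<in> \<F>"
      unfolding \<F>_def using Hol_compose[OF fH PH] f0 P(2) lifts_compose[OF fH fl a fa P(1,4)] by simp
    from m_le[OF this] have "m \<le> cmod (deriv f 0 * deriv P 0)"
      using DERIV_imp_deriv[OF deriv_compose_at_0[OF f(1) PH]] by (simp add: P(2))
    also have "\<dots> < cmod (deriv f 0) * 1"
      unfolding norm_mult using P(3) d0 by (intro mult_strict_left_mono) auto
    finally show False using up by simp
  qed
  from HolI[OF f(1) this] have "f \<in> Hol W" .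
  thus ?thesis using f0 d0 fl that by blast
qed

lemma ex_lifting_map_halfplane:
  assumes W: "open W" "W \<subseteq> halfplane" "w \<in> W"
  obtains f where "f \<in> Hol W" "f 0 = w" "deriv f 0 \<noteq> 0" "lifts f W"
proof -
  define T where "T = to_halfplane 1"
  define N where "N = of_halfplane 1"
  have one: "0 < Re 1" by simp
  have T: "T \<in> Hol halfplane" unfolding T_def by (rule Hol_to_halfplane[OF one])
  have N: "N holomorphic_on halfplane" unfolding N_def by (rule of_halfplane_holomorphic[OF one])
  have NB: "N v \<in> unit_disk" if "v \<in> halfplane" for v
    unfolding N_def by (rule of_halfplane_in_ball[OF one that])
  have TN: "T (N v) = v" if "v \<in> halfplane" for v
    unfolding T_def N_def by (rule to_of_halfplane[OF one that])
  have NT: "N (T z) = z" if "z \<in> unit_disk" for z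
    unfolding T_def N_def by (rule of_to_halfplane[OF one that])
  define V where "V = unit_disk \<inter> T -` W"
  have V: "open V" "V \<subseteq> unit_disk" "N w \<in> V"
  proof -
    show "open V" unfolding V_def
      by (rule continuous_open_preimage[OF holomorphic_on_imp_continuous_on[OF Hol_holomorphic[OF T]] open_ball W(1)])
    show "N w \<in> V" using W NB[of w] TN[of w] by (auto simp: V_def)
  qed (auto simp: V_def)
  obtain f where f: "f \<in> Hol V" "f 0 = N w" "deriv f 0 \<noteq> 0" "lifts f V"
    by (rule ex_lifting_map_disc[OF V]) blast
  have fH: "f \<in> Hol unit_disk" by (rule Hol_mono[OF f(1) V(2)])
  define g where "g = (\<lambda>z. T (f z))"
  have gH: "g \<in> Hol W"
    unfolding g_def
    by (rule Hol_compose_holomorphic[OF holomorphic_on_subset[OF Hol_holomorphic[OF T] V(2)] f(1)])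
       (auto simp: V_def)
  have gH': "g \<in> Hol halfplane" by (rule Hol_mono[OF gH W(2)])
  have wH: "w \<in> halfplane" using W by blast
  have g0: "g 0 = w" using TN[OF wH] by (simp add: g_def f(2))
  have "deriv g 0 \<noteq> 0"
  proof
    assume "deriv g 0 = 0"
    moreover have "(N has_field_derivative deriv N w) (at w)"
      by (rule holomorphic_derivI[OF N open_halfplane wH])
    ultimately have "((\<lambda>z. N (g z)) has_field_derivative 0) (at 0)"
      using DERIV_chain2[of N "deriv N w" "g" 0 0 UNIV] Hol_field_derivative[OF gH, of 0] g0 by auto
    moreover have "((\<lambda>z. N (g z)) has_field_derivative deriv f 0) (at 0)"
      by (rule has_field_derivative_transform_within_open[OF Hol_field_derivative[OF f(1)], of 0 unit_disk])
         (use NT Hol_in[OF fH] in \<open>auto simp: g_def\<close>)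
    ultimately show False using f(3) DERIV_unique by blast
  qed
  moreover have "lifts g W"
    unfolding lifts_def
  proof safe
    fix F \<zeta> assume F: "F \<in> Hol W" and \<zeta>: "\<zeta> \<in> unit_disk" and eq: "g \<zeta> = F 0"
    have FH: "F \<in> Hol halfplane" by (rule Hol_mono[OF F W(2)])
    have "(\<lambda>z. N (F z)) \<in> Hol V"
    proof (rule Hol_compose_holomorphic[OF holomorphic_on_subset[OF N W(2)] F])
      show "N v \<in> V" if "v \<in> W" for v using that W(2) NB[of v] TN[of v] by (auto simp: V_def)
    qed
    moreover have "f \<zeta> = N (F 0)"
      unfolding eq[symmetric] g_def by (rule NT[OF Hol_in[OF fH \<zeta>], symmetric])
    ultimately obtain G where G: "G \<in> Hol unit_disk" "G 0 = \<zeta>" "\<And>z. z \<in> unit_disk \<Longrightarrow> f (G z) = N (F z)"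
      using f(4) \<zeta> unfolding lifts_def by metis
    have "g (G z) = F z" if "z \<in> unit_disk" for z
      unfolding g_def G(3)[OF that] by (rule TN[OF Hol_in[OF FH that]])
    thus "\<exists>G\<in>Hol unit_disk. G 0 = \<zeta> \<and> (\<forall>z\<in>unit_disk. g (G z) = F z)"
      using G by blast
  qed
  ultimately show ?thesis using gH g0 that by blast
qed

section \<open>Circle means and harmonic majorants\<close>

definition circle_mean :: "(complex \<Rightarrow> real) \<Rightarrow> real \<Rightarrow> real" where
  "circle_mean g r = integral {0..2 * pi} (\<lambda>t. g (of_real r * cis t)) / (2 * pi)"

lemma circle_in_disc: "0 < r \<Longrightarrow> r < 1 \<Longrightarrow> of_real r * cis t \<in> unit_disk"
  by (simp add: norm_mult)

lemma continuous_on_circle: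
  assumes "continuous_on (sphere 0 r) g" "0 < r"
  shows "continuous_on S (\<lambda>t. g (of_real r * cis t))"
  by (rule continuous_on_compose2[OF assms(1)])
     (use assms(2) in \<open>auto intro!: continuous_intros simp: norm_mult\<close>)

lemma circle_mean_mono:
  assumes "continuous_on (sphere 0 r) g" "continuous_on (sphere 0 r) h" "0 < r"
    "\<And>z. cmod z = r \<Longrightarrow> g z \<le> h z"
  shows "circle_mean g r \<le> circle_mean h r"
  unfolding circle_mean_def
  by (intro divide_right_mono integral_le integrable_continuous_interval continuous_on_circle assms)
     (use assms(3) in \<open>auto simp: norm_mult\<close>)

lemma has_contour_integral_circlepath_iff:
  "(f has_contour_integral I) (circlepath c r) \<longleftrightarrow>
    ((\<lambda>t. f (c + of_real r * cis t) * of_real r * \<i> * cis t) has_integral I) {0..2 * pi}"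
  unfolding circlepath_def by (rule has_contour_integral_part_circlepath_iff) simp

lemma mean_value_circle:
  assumes "g holomorphic_on unit_disk" "0 < r" "r < 1"
  shows "circle_mean (\<lambda>z. Re (g z)) r = Re (g 0)"
proof -
  have "((\<lambda>u. g u / (u - 0)) has_contour_integral (2 * of_real pi * \<i> * g 0)) (circlepath 0 r)"
    by (rule Cauchy_integral_circlepath_simple)
       (use assms in \<open>auto intro!: holomorphic_on_subset[OF assms(1)]\<close>)
  hence "((\<lambda>t. g (of_real r * cis t) / (of_real r * cis t) * of_real r * \<i> * cis t) has_integral
      (2 * of_real pi * \<i> * g 0)) {0..2 * pi}"
    by (simp add: has_contour_integral_circlepath_iff)
  also have "(\<lambda>t. g (of_real r * cis t) / (of_real r * cis t) * of_real r * \<i> * cis t) =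
      (\<lambda>t. \<i> * g (of_real r * cis t))"
    using assms(2) by (simp add: fun_eq_iff)
  finally have int: "((\<lambda>t. - \<i> * (\<i> * g (of_real r * cis t))) has_integral
      - \<i> * (2 * of_real pi * \<i> * g 0)) {0..2 * pi}"
    by (rule has_integral_mult_right)
  have "- \<i> * (2 * of_real pi * \<i> * g 0) = 2 * of_real pi * g 0"
    by (simp add: complex_eq_iff)
  from int[unfolded this]
  have "((\<lambda>t. g (of_real r * cis t)) has_integral 2 * of_real pi * g 0) {0..2 * pi}"
    by simp
  from has_integral_linear[OF this bounded_linear_Re]
  have "((\<lambda>t. Re (g (of_real r * cis t))) has_integral 2 * pi * Re (g 0)) {0..2 * pi}"
    by (simp add: o_def)
  from integral_unique[OF this] show ?thesis by (simp add: circle_mean_def)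
qed

text \<open>The Poisson kernel in the two shapes in which it occurs: as the real part of the
  Herglotz kernel, and as the factor produced by Cauchy's formula with a reflected
  denominator.\<close>

lemma Poisson_kernel:
  assumes "cmod \<zeta> = R" "cmod z < R"
  shows "Re ((\<zeta> + z) / (\<zeta> - z)) = (R\<^sup>2 - (cmod z)\<^sup>2) / (cmod (\<zeta> - z))\<^sup>2"
    and "\<zeta> * of_real (R\<^sup>2 - (cmod z)\<^sup>2) / ((of_real (R\<^sup>2) - cnj z * \<zeta>) * (\<zeta> - z)) =
      of_real ((R\<^sup>2 - (cmod z)\<^sup>2) / (cmod (\<zeta> - z))\<^sup>2)"
proof -
  have "Re ((\<zeta> + z) / (\<zeta> - z)) = Re ((\<zeta> + z) * cnj (\<zeta> - z)) / (cmod (\<zeta> - z))\<^sup>2"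
    by (subst complex_div_cnj) (simp flip: of_real_power)
  also have "Re ((\<zeta> + z) * cnj (\<zeta> - z)) = (cmod \<zeta>)\<^sup>2 - (cmod z)\<^sup>2"
    unfolding cmod_power2 by (simp add: algebra_simps power2_eq_square)
  finally show "Re ((\<zeta> + z) / (\<zeta> - z)) = (R\<^sup>2 - (cmod z)\<^sup>2) / (cmod (\<zeta> - z))\<^sup>2"
    by (simp add: assms)
  have nz: "\<zeta> \<noteq> 0" "cnj (\<zeta> - z) \<noteq> 0" "\<zeta> - z \<noteq> 0" using assms by auto
  have "(of_real (R\<^sup>2) - cnj z * \<zeta>) = \<zeta> * cnj (\<zeta> - z)"
    using complex_norm_square[of \<zeta>] assms(1) by (simp add: algebra_simps)
  hence "\<zeta> * of_real (R\<^sup>2 - (cmod z)\<^sup>2) / ((of_real (R\<^sup>2) - cnj z * \<zeta>) * (\<zeta> - z)) =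
      of_real (R\<^sup>2 - (cmod z)\<^sup>2) / ((\<zeta> - z) * cnj (\<zeta> - z))"
    using nz by (simp add: divide_simps del: complex_cnj_diff)
  also have "(\<zeta> - z) * cnj (\<zeta> - z) = of_real ((cmod (\<zeta> - z))\<^sup>2)"
    using complex_norm_square[of "\<zeta> - z"] by simp
  finally show "\<zeta> * of_real (R\<^sup>2 - (cmod z)\<^sup>2) / ((of_real (R\<^sup>2) - cnj z * \<zeta>) * (\<zeta> - z)) =
      of_real ((R\<^sup>2 - (cmod z)\<^sup>2) / (cmod (\<zeta> - z))\<^sup>2)"
    by simp
qed

text \<open>This is the subharmonicity of \<open>|k|\<close>: represent \<open>k z\<close> by its
  Poisson integral and take absolute values under the integral, the kernel being
  nonnegative.\<close>

lemma norm_le_Poisson_integral: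
  assumes k: "k holomorphic_on cball 0 R" and z: "cmod z < R"
  shows "2 * pi * cmod (k z) \<le> integral {0..2 * pi} (\<lambda>t. cmod (k (of_real R * cis t)) *
    Re ((of_real R * cis t + z) / (of_real R * cis t - z)))"
proof -
  have R: "0 < R" using z by (rule le_less_trans[OF norm_ge_zero])
  define P where "P = (\<lambda>\<zeta>. (R\<^sup>2 - (cmod z)\<^sup>2) / (cmod (\<zeta> - z))\<^sup>2)"
  have P0: "0 \<le> P \<zeta>" for \<zeta>
    using z by (auto simp: P_def intro!: divide_nonneg_nonneg power_mono)
  \<comment> \<open>The extra factor equals 1 at \<open>z\<close> and turns the Cauchy kernel on the
    circle into the Poisson kernel.\<close>
  define m where "m = (\<lambda>\<zeta>. k \<zeta> * of_real (R\<^sup>2 - (cmod z)\<^sup>2) / (of_real (R\<^sup>2) - cnj z * \<zeta>))"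
  have nz: "of_real (R\<^sup>2) - cnj z * \<zeta> \<noteq> 0" if "\<zeta> \<in> cball 0 R" for \<zeta>
  proof
    assume "of_real (R\<^sup>2) - cnj z * \<zeta> = 0"
    hence "cmod (of_real (R\<^sup>2)) = cmod (cnj z * \<zeta>)" by simp
    hence "R * R = cmod z * cmod \<zeta>" by (simp add: norm_mult power2_eq_square norm_power)
    moreover have "cmod z * cmod \<zeta> \<le> cmod z * R" using that by (intro mult_left_mono) auto
    moreover have "cmod z * R < R * R" using z R by simp
    ultimately show False by simp
  qed
  have "m holomorphic_on cball 0 R"
    unfolding m_def by (intro holomorphic_intros k nz)
  hence "((\<lambda>u. m u / (u - z)) has_contour_integral (2 * of_real pi * \<i> * m z)) (circlepath 0 R)"
    by (rule Cauchy_integral_circlepath_simple) (use z in auto)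
  moreover have "m z = k z"
  proof -
    have "of_real (R\<^sup>2 - (cmod z)\<^sup>2) = of_real (R\<^sup>2) - cnj z * z"
      using complex_norm_square[of z] by (simp add: mult.commute)
    thus ?thesis using nz[of z] z unfolding m_def by simp
  qed
  ultimately have "((\<lambda>t. m (of_real R * cis t) / (of_real R * cis t - z) * of_real R * \<i> * cis t) has_integral
      2 * of_real pi * \<i> * k z) {0..2 * pi}"
    by (simp add: has_contour_integral_circlepath_iff)
  also have "(\<lambda>t. m (of_real R * cis t) / (of_real R * cis t - z) * of_real R * \<i> * cis t) =
      (\<lambda>t. \<i> * (k (of_real R * cis t) * of_real (P (of_real R * cis t))))"
  proof
    fix t
    define \<zeta> where "\<zeta> = of_real R * cis t"
    have "cmod \<zeta> = R" using R by (simp add: \<zeta>_def norm_mult)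
    note PK = Poisson_kernel(2)[OF this z]
    have "m \<zeta> / (\<zeta> - z) * of_real R * \<i> * cis t = \<i> * k \<zeta> * (\<zeta> * of_real (R\<^sup>2 - (cmod z)\<^sup>2) / ((of_real (R\<^sup>2) - cnj z * \<zeta>) * (\<zeta> - z)))"
      by (simp add: m_def \<zeta>_def)
    thus "m (of_real R * cis t) / (of_real R * cis t - z) * of_real R * \<i> * cis t =
      \<i> * (k (of_real R * cis t) * of_real (P (of_real R * cis t)))"
      unfolding PK unfolding \<zeta>_def P_def by (simp only: mult.assoc)
  qed
  finally have int: "((\<lambda>t. \<i> * (k (of_real R * cis t) * of_real (P (of_real R * cis t)))) has_integral
    2 * of_real pi * \<i> * k z) {0..2 * pi}" .
  have "sphere 0 R \<subseteq> cball 0 R" by auto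
  hence ck: "continuous_on (sphere 0 R) k"
    by (rule continuous_on_subset[OF holomorphic_on_imp_continuous_on[OF k]])
  have cP: "continuous_on (sphere 0 R) P"
    unfolding P_def using z by (intro continuous_intros) auto
  have "cmod (2 * of_real pi * \<i> * k z) \<le> integral {0..2 * pi} (\<lambda>t. cmod (k (of_real R * cis t)) * P (of_real R * cis t))"
    unfolding integral_unique[OF int, symmetric]
  proof (rule integral_norm_bound_integral)
    show "(\<lambda>t. \<i> * (k (of_real R * cis t) * of_real (P (of_real R * cis t)))) integrable_on {0..2 * pi}"
      using int by (rule has_integral_integrable)
    show "(\<lambda>t. cmod (k (of_real R * cis t)) * P (of_real R * cis t)) integrable_on {0..2 * pi}"
      by (intro integrable_continuous_interval continuous_on_circle[of R "\<lambda>z. cmod (k z) * P z"] continuous_intros ck cP R)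
  qed (use P0 in \<open>simp add: norm_mult\<close>)
  moreover have "P (of_real R * cis t) = Re ((of_real R * cis t + z) / (of_real R * cis t - z))" for t
    unfolding P_def using R z by (subst Poisson_kernel(1)) (auto simp: norm_mult)
  ultimately show ?thesis by (simp add: norm_mult)
qed

text \<open>\<open>Re K\<close> is the Poisson integral of the boundary values of
  \<open>|k|\<close>. A holomorphic \<open>K\<close> is kept instead of the harmonic function, so
  that Montel's theorem and the maximum modulus principle are available.\<close>

lemma Herglotz_integral:
  assumes k: "k holomorphic_on cball 0 R" and R: "0 < R"
  obtains K where "K holomorphic_on ball 0 R" "K 0 = of_real (circle_mean (\<lambda>z. cmod (k z)) R)"
    "\<And>z. z \<in> ball 0 R \<Longrightarrow> cmod (k z) \<le> Re (K z)"
proof -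
  define c where "c = (\<lambda>z. of_real (cmod (k z)) :: complex)"
  have "sphere 0 R \<subseteq> cball 0 R" by auto
  hence ck: "continuous_on (sphere 0 R) k"
    by (rule continuous_on_subset[OF holomorphic_on_imp_continuous_on[OF k]])
  hence cc: "continuous_on (sphere 0 R) c" unfolding c_def by (intro continuous_intros)
  hence cc': "continuous_on (path_image (circlepath 0 R)) c" using R by simp
  define J where "J = (\<lambda>w. contour_integral (circlepath 0 R) (\<lambda>u. c u / (u - w)))"
  have int: "((\<lambda>u. c u / (u - w)) has_contour_integral J w) (circlepath 0 R)" if "w \<in> ball 0 R" for w
    unfolding J_def
  proof (rule has_contour_integral_integral, rule contour_integrable_continuous_circlepath)
    show "continuous_on (path_image (circlepath 0 R)) (\<lambda>u. c u / (u - w))"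
      using that R by (intro continuous_intros cc') auto
  qed
  \<comment> \<open>A Cauchy integral with merely continuous density is holomorphic off the
    circle.\<close>
  have Jd: "\<exists>d. (J has_field_derivative d) (at w)" if w: "w \<in> ball 0 R" for w
    using Cauchy_next_derivative_circlepath(2)[OF cc', of 1 J w] int w by auto
  hence Jh: "J holomorphic_on ball 0 R"
    by (meson field_differentiable_at_within field_differentiable_def holomorphic_on_def)
  \<comment> \<open>Comes from \<open>(\<zeta> + z) / (\<zeta> - z) = 2 * \<zeta> / (\<zeta> - z) -
    1\<close>.\<close>
  define K where "K = (\<lambda>z. (2 * J z - J 0) / (2 * of_real pi * \<i>))"
  have Kint: "((\<lambda>t. c (of_real R * cis t) * ((of_real R * cis t + z) / (of_real R * cis t - z))) has_integral
      2 * of_real pi * K z) {0..2 * pi}" if z: "z \<in> ball 0 R" for z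
  proof -
    have "((\<lambda>u. 2 * (c u / (u - z)) - c u / (u - 0)) has_contour_integral (2 * J z - J 0)) (circlepath 0 R)"
      by (intro has_contour_integral_diff has_contour_integral_lmul int z) (use R in auto)
    hence "((\<lambda>t. (2 * (c (of_real R * cis t) / (of_real R * cis t - z)) - c (of_real R * cis t) / (of_real R * cis t)) * of_real R * \<i> * cis t)
        has_integral (2 * J z - J 0)) {0..2 * pi}"
      by (simp add: has_contour_integral_circlepath_iff)
    also have "(\<lambda>t. (2 * (c (of_real R * cis t) / (of_real R * cis t - z)) - c (of_real R * cis t) / (of_real R * cis t)) * of_real R * \<i> * cis t) =
      (\<lambda>t. \<i> * (c (of_real R * cis t) * ((of_real R * cis t + z) / (of_real R * cis t - z))))"
    proof
      fix t
      define \<zeta> where "\<zeta> = of_real R * cis t"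
      have "cmod \<zeta> = R" using R by (simp add: \<zeta>_def norm_mult)
      hence nz: "\<zeta> \<noteq> 0" "\<zeta> - z \<noteq> 0" using R z by auto
      have "(2 * (c \<zeta> / (\<zeta> - z)) - c \<zeta> / \<zeta>) * \<i> * \<zeta> = \<i> * (c \<zeta> * ((\<zeta> + z) / (\<zeta> - z)))"
        using nz by (simp add: field_simps)
      thus "(2 * (c (of_real R * cis t) / (of_real R * cis t - z)) - c (of_real R * cis t) / (of_real R * cis t)) * of_real R * \<i> * cis t =
        \<i> * (c (of_real R * cis t) * ((of_real R * cis t + z) / (of_real R * cis t - z)))"
        unfolding \<zeta>_def by (simp add: mult_ac)
    qed
    finally have int': "((\<lambda>t. - \<i> * (\<i> * (c (of_real R * cis t) * ((of_real R * cis t + z) / (of_real R * cis t - z)))))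
       has_integral (- \<i> * (2 * J z - J 0))) {0..2 * pi}"
      by (rule has_integral_mult_right)
    have "- \<i> * (2 * J z - J 0) = 2 * of_real pi * K z"
      by (simp add: K_def field_simps)
    from int'[unfolded this] show ?thesis by simp
  qed
  show ?thesis
  proof (rule that)
    show "K holomorphic_on ball 0 R"
      unfolding K_def by (intro holomorphic_intros Jh) auto
    have "2 * of_real pi * K 0 = integral {0..2 * pi} (\<lambda>t. c (of_real R * cis t) * ((of_real R * cis t + 0) / (of_real R * cis t - 0)))"
      by (rule integral_unique[OF Kint, symmetric]) (use R in simp)
    also have "\<dots> = integral {0..2 * pi} (\<lambda>t. c (of_real R * cis t))"
      using R by simp
    finally have K0: "2 * of_real pi * K 0 = integral {0..2 * pi} (\<lambda>t. c (of_real R * cis t))" .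
    have ci: "(\<lambda>t. cmod (k (of_real R * cis t))) integrable_on {0..2 * pi}"
      by (intro integrable_continuous_interval continuous_on_circle[of R "\<lambda>z. cmod (k z)"] continuous_on_norm ck R)
    have "2 * of_real pi * K 0 = of_real (integral {0..2 * pi} (\<lambda>t. cmod (k (of_real R * cis t))))"
      unfolding K0
      using integral_linear[of "\<lambda>t. cmod (k (of_real R * cis t))" "{0..2 * pi}" complex_of_real]
        ci bounded_linear_of_real
      by (simp add: o_def c_def)
    thus "K 0 = of_real (circle_mean (\<lambda>z. cmod (k z)) R)"
      by (simp add: circle_mean_def field_simps)
    fix z :: complex assume z: "z \<in> ball 0 R"
    have Rec: "Re (c w * x) = cmod (k w) * Re x" for w x by (simp add: c_def)
    have "2 * pi * cmod (k z) \<le> integral {0..2 * pi} (\<lambda>t. cmod (k (of_real R * cis t)) *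
      Re ((of_real R * cis t + z) / (of_real R * cis t - z)))"
      by (rule norm_le_Poisson_integral[OF k]) (use z in auto)
    also have "\<dots> = 2 * pi * Re (K z)"
      using integral_unique[OF has_integral_linear[OF Kint[OF z] bounded_linear_Re]]
      unfolding o_def Rec by simp
    finally show "cmod (k z) \<le> Re (K z)" by simp
  qed
qed

text \<open>The Poisson majorants on discs of radius tending to 1, rescaled to the unit disc, have a
  convergent subsequence. As \<open>k\<close> has no zeros, they map into the open half-plane, where
  the value at 0 controls growth; that value is a circle mean, hence at most
  \<open>M\<close>.\<close>

lemma ex_harmonic_majorant:
  assumes k: "k holomorphic_on unit_disk" "\<And>z. z \<in> unit_disk \<Longrightarrow> k z \<noteq> 0"
    and M: "\<And>r. 0 < r \<Longrightarrow> r < 1 \<Longrightarrow> circle_mean (\<lambda>z. cmod (k z)) r \<le> M"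
  obtains K where "K holomorphic_on unit_disk" "\<And>z. z \<in> unit_disk \<Longrightarrow> cmod (k z) \<le> Re (K z)" "Re (K 0) \<le> M"
proof -
  \<comment> \<open>The radius is \<open>1 - 1 / (n + 2)\<close>; the shift makes it positive
    already for \<open>n = 0\<close>.\<close>
  define R where "R = (\<lambda>n. 1 - inverse (real (Suc (n + 1))))"
  have R: "0 < R n" "R n < 1" for n by (auto simp: R_def field_simps)
  have Rlim: "R \<longlonglongrightarrow> 1"
    using tendsto_diff[OF tendsto_const LIMSEQ_ignore_initial_segment[OF LIMSEQ_inverse_real_of_nat, of 1], of 1]
    by (simp only: R_def diff_zero)
  have "\<exists>K. K holomorphic_on ball 0 (R n) \<and> K 0 = of_real (circle_mean (\<lambda>z. cmod (k z)) (R n)) \<and>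
    (\<forall>z\<in>ball 0 (R n). cmod (k z) \<le> Re (K z))" for n
    by (rule Herglotz_integral[of k "R n", OF holomorphic_on_subset[OF k(1)] R(1)]) (use R(2)[of n] in auto)
  then obtain K where K: "\<And>n. K n holomorphic_on ball 0 (R n)"
    "\<And>n. K n 0 = of_real (circle_mean (\<lambda>z. cmod (k z)) (R n))"
    "\<And>n z. z \<in> ball 0 (R n) \<Longrightarrow> cmod (k z) \<le> Re (K n z)" by metis
  define L where "L = (\<lambda>n z. K n (of_real (R n) * z))"
  have sc: "of_real (R n) * z \<in> ball 0 (R n)" "of_real (R n) * z \<in> unit_disk" if "z \<in> unit_disk" for n z
  proof -
    have "cmod (of_real (R n) * z) < R n" using R[of n] that by (simp add: norm_mult)
    thus "of_real (R n) * z \<in> ball 0 (R n)" "of_real (R n) * z \<in> unit_disk" using R(2)[of n] by auto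
  qed
  have Lge: "cmod (k (of_real (R n) * z)) \<le> Re (L n z)" if "z \<in> unit_disk" for n z
    unfolding L_def by (rule K(3)[OF sc(1)[OF that]])
  have LH: "L n \<in> Hol halfplane" for n
  proof (rule HolI)
    show "L n holomorphic_on unit_disk"
      unfolding L_def
      by (rule holomorphic_on_compose_gen[OF _ K(1), unfolded o_def])
         (use sc in \<open>auto intro!: holomorphic_intros\<close>)
    show "L n z \<in> halfplane" if "z \<in> unit_disk" for z
      using Lge[OF that, of n] k(2)[OF sc(2)[OF that], of n] unfolding halfplane_def
      by (metis (mono_tags) less_le_trans mem_Collect_eq zero_less_norm_iff)
  qed
  have L0: "cmod (L n 0) \<le> \<bar>M\<bar>" "Re (L n 0) \<le> M" for n
  proof -
    have "0 < Re (L n 0)" using Hol_in[OF LH, of 0] by (simp add: halfplane_def)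
    moreover have "L n 0 = of_real (circle_mean (\<lambda>z. cmod (k z)) (R n))" by (simp add: L_def K(2))
    ultimately show "cmod (L n 0) \<le> \<bar>M\<bar>" "Re (L n 0) \<le> M" using M[OF R, of n] by auto
  qed
  define \<H> where "\<H> = {h \<in> Hol halfplane. cmod (h 0) \<le> \<bar>M\<bar>}"
  have hol: "h holomorphic_on unit_disk" if "h \<in> \<H>" for h
    using that Hol_holomorphic by (auto simp: \<H>_def)
  have bd: "\<exists>B. \<forall>h\<in>\<H>. \<forall>z\<in>S. cmod (h z) \<le> B" if "compact S" "S \<subseteq> unit_disk" for S
  proof -
    have "continuous_on S (\<lambda>z. (1 + cmod z) / (1 - cmod z))"
      using that(2) by (intro continuous_intros) auto
    from compact_imp_bounded[OF compact_continuous_image[OF this that(1)]]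
    obtain B where B: "\<And>z. z \<in> S \<Longrightarrow> norm ((1 + cmod z) / (1 - cmod z)) \<le> B"
      unfolding bounded_iff by blast
    have "cmod (h z) \<le> \<bar>M\<bar> * B" if h: "h \<in> \<H>" and z: "z \<in> S" for h z
    proof -
      have "cmod (h z) \<le> cmod (h 0) * ((1 + cmod z) / (1 - cmod z))"
        using h z \<open>S \<subseteq> unit_disk\<close> by (intro halfplane_growth) (auto simp: \<H>_def)
      also have "\<dots> \<le> \<bar>M\<bar> * B"
      proof (rule mult_mono)
        show "(1 + cmod z) / (1 - cmod z) \<le> B" by (rule abs_le_D1[OF B[OF z, unfolded real_norm_def]])
        have "z \<in> unit_disk" using z \<open>S \<subseteq> unit_disk\<close> by blast
        thus "0 \<le> (1 + cmod z) / (1 - cmod z)" by simp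
      qed (use h in \<open>auto simp: \<H>_def\<close>)
      finally show ?thesis .
    qed
    thus ?thesis by blast
  qed
  have rng: "range L \<subseteq> \<H>" using LH L0 by (auto simp: \<H>_def)
  show ?thesis
  proof (rule Montel[OF open_ball hol bd rng])
    fix g r
    assume g: "g holomorphic_on unit_disk" and r: "strict_mono (r :: nat \<Rightarrow> nat)"
      and lim: "\<And>z. z \<in> unit_disk \<Longrightarrow> (\<lambda>n. L (r n) z) \<longlonglongrightarrow> g z"
    have "cmod (k z) \<le> Re (g z)" if z: "z \<in> unit_disk" for z
    proof (rule LIMSEQ_le)
      show "(\<lambda>n. Re (L (r n) z)) \<longlonglongrightarrow> Re (g z)" by (intro tendsto_intros lim z)
      show "\<exists>N. \<forall>n\<ge>N. cmod (k (of_real (R (r n)) * z)) \<le> Re (L (r n) z)" using Lge[OF z] by blast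
      have "(\<lambda>n. of_real (R (r n)) * z) \<longlonglongrightarrow> of_real 1 * z"
        using LIMSEQ_subseq_LIMSEQ[OF Rlim r] by (intro tendsto_intros) (simp add: o_def)
      hence "(\<lambda>n. of_real (R (r n)) * z) \<longlonglongrightarrow> z" by simp
      moreover have "isCont k z"
        using holomorphic_on_imp_continuous_on[OF k(1)] z by (simp add: continuous_on_eq_continuous_at)
      ultimately show "(\<lambda>n. cmod (k (of_real (R (r n)) * z))) \<longlonglongrightarrow> cmod (k z)"
        by (intro tendsto_norm isCont_tendsto_compose[of z k])
    qed
    moreover have "Re (g 0) \<le> M"
    proof (rule LIMSEQ_le_const2)
      show "(\<lambda>n. Re (L (r n) 0)) \<longlonglongrightarrow> Re (g 0)" by (intro tendsto_intros lim) simp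
    qed (use L0 in blast)
    ultimately show ?thesis by (rule that[OF g])
  qed
qed

section \<open>The punctured half-plane and its Hardy number\<close>

definition dyadic :: "complex set" where
  "dyadic = range (\<lambda>n::int. of_real (2 powr of_int n))"

definition punctured_halfplane :: "complex set" where
  "punctured_halfplane = halfplane - dyadic"

lemma punctured_halfplane_subset: "punctured_halfplane \<subseteq> halfplane"
  by (auto simp: punctured_halfplane_def)

text \<open>The powers of 2 accumulate only at 0 and at infinity, and the region stays away from
  both.\<close>

lemma finite_dyadic_Int:
  assumes "0 < a"
  shows "finite (dyadic \<inter> {w. a \<le> Re w \<and> cmod w \<le> b})"
proof (rule finite_subset)
  show "dyadic \<inter> {w. a \<le> Re w \<and> cmod w \<le> b} \<subseteq>
    (\<lambda>n::int. of_real (2 powr of_int n)) ` {\<lfloor>log 2 a\<rfloor>..\<lceil>log 2 b\<rceil>}"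
  proof
    fix w assume w: "w \<in> dyadic \<inter> {w. a \<le> Re w \<and> cmod w \<le> b}"
    then obtain n :: int where n: "w = of_real (2 powr of_int n)" by (auto simp: dyadic_def)
    have ab: "a \<le> 2 powr of_int n" "2 powr of_int n \<le> b" using w by (auto simp: n)
    have "0 < b" by (rule less_le_trans[OF _ ab(2)]) simp
    have "log 2 a \<le> of_int n" using ab(1) assms by (simp add: log_le_iff)
    moreover have "of_int n \<le> log 2 b" using ab(2) \<open>0 < b\<close> by (simp add: le_log_iff)
    ultimately have "n \<in> {\<lfloor>log 2 a\<rfloor>..\<lceil>log 2 b\<rceil>}"
      by (auto simp: floor_le_iff le_ceiling_iff)
    thus "w \<in> (\<lambda>n::int. of_real (2 powr of_int n)) ` {\<lfloor>log 2 a\<rfloor>..\<lceil>log 2 b\<rceil>}"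
      unfolding n by (rule imageI)
  qed
qed simp

lemma open_punctured_halfplane: "open punctured_halfplane"
  unfolding open_subopen[of punctured_halfplane]
proof
  fix w assume w: "w \<in> punctured_halfplane"
  define T where "T = dyadic \<inter> {v. Re w / 2 \<le> Re v \<and> cmod v \<le> cmod w + 1}"
  have Rw: "0 < Re w" using w by (auto simp: punctured_halfplane_def halfplane_def)
  have "closed T" unfolding T_def by (intro finite_imp_closed finite_dyadic_Int) (use Rw in simp)
  hence "open ({v. Re w / 2 < Re v} \<inter> ball 0 (cmod w + 1) - T)"
    by (intro open_Diff open_Int open_ball open_halfspace_Re_gt)
  moreover have "w \<in> {v. Re w / 2 < Re v} \<inter> ball 0 (cmod w + 1) - T"
    using w Rw by (auto simp: T_def punctured_halfplane_def)
  moreover have "{v. Re w / 2 < Re v} \<inter> ball 0 (cmod w + 1) - T \<subseteq> punctured_halfplane"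
    using Rw by (auto simp: T_def punctured_halfplane_def halfplane_def)
  ultimately show "\<exists>T. open T \<and> w \<in> T \<and> T \<subseteq> punctured_halfplane" by blast
qed

lemma in_punctured_halfplaneI: "0 < Re w \<Longrightarrow> Im w \<noteq> 0 \<Longrightarrow> w \<in> punctured_halfplane"
  by (auto simp: punctured_halfplane_def halfplane_def dyadic_def)

lemma complex_domain_punctured_halfplane: "complex_domain punctured_halfplane"
proof -
  have "connected punctured_halfplane"
    unfolding punctured_halfplane_def
    by (rule connected_open_diff_countable)
       (auto intro: open_halfplane convex_connected convex_halfplane simp: dyadic_def)
  moreover have "Complex 1 1 \<in> punctured_halfplane" by (rule in_punctured_halfplaneI) auto
  ultimately show ?thesis using open_punctured_halfplane by (auto simp: complex_domain_def)
qed

section \<open>Hardy spaces in terms of circle means\<close>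

lemma continuous_on_norm_powr:
  assumes "continuous_on S f" "0 < p"
  shows "continuous_on S (\<lambda>x. cmod (f x) powr p)"
  using assms by (intro continuous_on_powr' continuous_intros) auto

lemma continuous_on_circle_sphere:
  assumes "f holomorphic_on unit_disk" "0 < r" "r < 1"
  shows "continuous_on (sphere 0 r) f"
  by (rule continuous_on_subset[OF holomorphic_on_imp_continuous_on[OF assms(1)]]) (use assms in auto)

lemma nn_integral_circle:
  assumes F: "F holomorphic_on unit_disk" and r: "0 < r" "r < 1" and p: "0 < p"
  shows "(\<integral>\<^sup>+ \<theta>\<in>{0..2 * pi}. ennreal (cmod (F (of_real r * exp (\<i> * of_real \<theta>))) powr p) \<partial>lborel)
    = ennreal (2 * pi * circle_mean (\<lambda>z. cmod (F z) powr p) r)"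
proof -
  have "(\<lambda>\<theta>. cmod (F (of_real r * cis \<theta>)) powr p) integrable_on {0..2 * pi}"
    by (intro integrable_continuous_interval continuous_on_circle[of r "\<lambda>z. cmod (F z) powr p"]
         continuous_on_norm_powr continuous_on_circle_sphere F r p)
  from nn_integral_has_integral_lebesgue'[OF _ integrable_integral[OF this]]
  have "(\<integral>\<^sup>+ \<theta>\<in>{0..2 * pi}. ennreal (cmod (F (of_real r * cis \<theta>)) powr p) \<partial>lborel) =
    ennreal (integral {0..2 * pi} (\<lambda>\<theta>. cmod (F (of_real r * cis \<theta>)) powr p))" by simp
  thus ?thesis by (simp add: circle_mean_def cis_conv_exp)
qed

lemma hardy_space_circle_mean_bound:
  assumes "F \<in> hardy_space p" "0 < p"
  obtains M where "\<And>r. 0 < r \<Longrightarrow> r < 1 \<Longrightarrow> circle_mean (\<lambda>z. cmod (F z) powr p) r \<le> M"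
proof -
  define s where "s = (SUP r\<in>{0<..<1::real}. \<integral>\<^sup>+ \<theta>\<in>{0..2 * pi}.
        ennreal (cmod (F (of_real r * exp (\<i> * of_real \<theta>))) powr p) \<partial>lborel)"
  have F: "F holomorphic_on unit_disk" and "s < \<infinity>" using assms by (auto simp: hardy_space_def s_def)
  then obtain M where M: "0 \<le> M" "s = ennreal M" by (cases s) auto
  have "circle_mean (\<lambda>z. cmod (F z) powr p) r \<le> M / (2 * pi)" if r: "0 < r" "r < 1" for r
  proof -
    have "ennreal (2 * pi * circle_mean (\<lambda>z. cmod (F z) powr p) r) \<le> s"
      unfolding nn_integral_circle[OF F r assms(2), symmetric] s_def
      by (rule SUP_upper) (use r in auto)
    thus ?thesis using M by (simp add: ennreal_le_iff field_simps)
  qed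
  thus ?thesis by (rule that)
qed

lemma hardy_spaceI:
  assumes F: "F holomorphic_on unit_disk" and p: "0 < p"
    and M: "\<And>r. 0 < r \<Longrightarrow> r < 1 \<Longrightarrow> circle_mean (\<lambda>z. cmod (F z) powr p) r \<le> M"
  shows "F \<in> hardy_space p"
proof -
  have "(SUP r\<in>{0<..<1::real}. \<integral>\<^sup>+ \<theta>\<in>{0..2 * pi}.
        ennreal (cmod (F (of_real r * exp (\<i> * of_real \<theta>))) powr p) \<partial>lborel) \<le> ennreal (2 * pi * M)"
  proof (rule SUP_least)
    fix r :: real assume "r \<in> {0<..<1}"
    thus "(\<integral>\<^sup>+ \<theta>\<in>{0..2 * pi}.
        ennreal (cmod (F (of_real r * exp (\<i> * of_real \<theta>))) powr p) \<partial>lborel) \<le> ennreal (2 * pi * M)"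
      using M[of r] by (subst nn_integral_circle[OF F _ _ p]) (auto intro!: ennreal_leI)
  qed
  also have "\<dots> < \<infinity>" by simp
  finally show ?thesis using F by (simp add: hardy_space_def)
qed

text \<open>\<open>k\<close> is the branch of the \<open>p\<close>-th power of \<open>F\<close>
  given by the principal logarithm. It turns \<open>|F| powr p\<close> into the modulus of a
  zero-free holomorphic function, the form that the construction of harmonic majorants
  needs.\<close>

lemma Hol_halfplane_powr:
  assumes "F \<in> Hol halfplane"
  obtains k where "k holomorphic_on unit_disk" "\<And>z. z \<in> unit_disk \<Longrightarrow> k z \<noteq> 0"
    "\<And>z. z \<in> unit_disk \<Longrightarrow> cmod (k z) = cmod (F z) powr p"
    "\<And>z. z \<in> unit_disk \<Longrightarrow> Re (k z) = cmod (F z) powr p * cos (p * Arg (F z))"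
proof
  have nz: "F z \<noteq> 0" "F z \<notin> \<real>\<^sub>\<le>\<^sub>0" if "z \<in> unit_disk" for z
    using Hol_in[OF assms that] by (auto simp: halfplane_def complex_nonpos_Reals_iff)
  show "(\<lambda>z. exp (of_real p * Ln (F z))) holomorphic_on unit_disk"
    using Hol_holomorphic[OF assms] nz by (intro holomorphic_intros) auto
  show "cmod (exp (of_real p * Ln (F z))) = cmod (F z) powr p"
    "Re (exp (of_real p * Ln (F z))) = cmod (F z) powr p * cos (p * Arg (F z))" if "z \<in> unit_disk" for z
    using nz[OF that] by (auto simp: powr_def Re_exp Arg_eq_Im_Ln)
qed auto

text \<open>A real supremum, hence meaningful only when the set of means is bounded above.\<close>

definition mean_envelope :: "complex set \<Rightarrow> real \<Rightarrow> complex \<Rightarrow> real" where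
  "mean_envelope D p w = Sup {circle_mean (\<lambda>z. cmod (F z) powr p) r | F r.
     F \<in> Hol D \<and> F 0 = w \<and> 0 < r \<and> r < 1}"

section \<open>The envelope of means: harmonic majorants and semicontinuity\<close>

text \<open>Subordination: a majorant of \<open>|f| powr p\<close> pulls back along \<open>G\<close>
  to a majorant of \<open>|F| powr p\<close>, and the mean value property evaluates its circle mean
  at \<open>G 0\<close>.\<close>

lemma circle_mean_le_harmonic:
  assumes f: "f \<in> Hol D" and p: "0 < p"
    and K: "K holomorphic_on unit_disk" "\<And>z. z \<in> unit_disk \<Longrightarrow> cmod (f z) powr p \<le> Re (K z)"
    and F: "F \<in> Hol E" "G \<in> Hol unit_disk" "\<And>z. z \<in> unit_disk \<Longrightarrow> f (G z) = F z" and r: "0 < r" "r < 1"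
  shows "circle_mean (\<lambda>z. cmod (F z) powr p) r \<le> Re (K (G 0))"
proof -
  have KG: "(\<lambda>z. K (G z)) holomorphic_on unit_disk"
    using Hol_compose[of K UNIV, OF _ F(2)] K(1) by (simp add: Hol_def)
  have "circle_mean (\<lambda>z. cmod (F z) powr p) r \<le> circle_mean (\<lambda>z. Re (K (G z))) r"
  proof (rule circle_mean_mono)
    show "cmod (F z) powr p \<le> Re (K (G z))" if "cmod z = r" for z
      using that r F(3)[of z] K(2)[OF Hol_in[OF F(2), of z]] by simp
    show "continuous_on (sphere 0 r) (\<lambda>z. cmod (F z) powr p)"
      by (intro continuous_on_norm_powr continuous_on_circle_sphere Hol_holomorphic[OF F(1)] r p)
    show "continuous_on (sphere 0 r) (\<lambda>z. Re (K (G z)))"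
      by (intro continuous_intros continuous_on_circle_sphere KG r)
  qed (fact r)
  also have "\<dots> = Re (K (G 0))" by (rule mean_value_circle[OF KG r])
  finally show ?thesis .
qed

lemma mean_envelope_nonempty:
  assumes "w \<in> D"
  shows "{circle_mean (\<lambda>z. cmod (F z) powr p) r | F r. F \<in> Hol D \<and> F 0 = w \<and> 0 < r \<and> r < 1} \<noteq> {}"
proof -
  have "(\<lambda>_. w) \<in> Hol D" using assms by (auto simp: Hol_def)
  thus ?thesis by (auto intro!: exI[of _ "\<lambda>_. w"] exI[of _ "1/2::real"])
qed

text \<open>Superharmonicity of the envelope at \<open>w\<close>: along \<open>f\<close> it lies
  below a harmonic function that does not exceed it at \<open>w\<close>. A competitor based at
  \<open>f z\<close> factors as \<open>f (G _)\<close> with \<open>G 0 = z\<close>, so its means are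
  at most \<open>Re (K z)\<close>.\<close>

lemma mean_envelope_along_lift:
  assumes D: "open D" "D \<subseteq> halfplane" and p: "0 < p" and H: "Hol D \<subseteq> hardy_space p" and w: "w \<in> D"
  obtains f K where "f \<in> Hol D" "f 0 = w" "deriv f 0 \<noteq> 0" "K holomorphic_on unit_disk"
    "Re (K 0) \<le> mean_envelope D p w" "\<And>z. z \<in> unit_disk \<Longrightarrow> mean_envelope D p (f z) \<le> Re (K z)"
    "bdd_above {circle_mean (\<lambda>z. cmod (F z) powr p) r | F r. F \<in> Hol D \<and> F 0 = w \<and> 0 < r \<and> r < 1}"
proof -
  obtain f where f: "f \<in> Hol D" "f 0 = w" "deriv f 0 \<noteq> 0" "lifts f D"
    by (rule ex_lifting_map_halfplane[OF D w]) blast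
  obtain k where k: "k holomorphic_on unit_disk" "\<And>z. z \<in> unit_disk \<Longrightarrow> k z \<noteq> 0"
    "\<And>z. z \<in> unit_disk \<Longrightarrow> cmod (k z) = cmod (f z) powr p"
    by (rule Hol_halfplane_powr[OF Hol_mono[OF f(1) D(2)], of p]) blast
  have km: "circle_mean (\<lambda>z. cmod (k z)) r = circle_mean (\<lambda>z. cmod (f z) powr p) r" if "0 < r" "r < 1" for r
    unfolding circle_mean_def using k(3)[OF circle_in_disc[OF that]] by simp
  have bound: "x \<le> Re (K z)" if K: "K holomorphic_on unit_disk" "\<And>z. z \<in> unit_disk \<Longrightarrow> cmod (k z) \<le> Re (K z)"
    and z: "z \<in> unit_disk" and "x \<in> {circle_mean (\<lambda>z. cmod (F z) powr p) r | F r. F \<in> Hol D \<and> F 0 = f z \<and> 0 < r \<and> r < 1}"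
    for K z x
  proof -
    from that obtain F r where F: "F \<in> Hol D" "F 0 = f z" and r: "0 < r" "r < 1"
      and x: "x = circle_mean (\<lambda>z. cmod (F z) powr p) r" by blast
    from bspec[OF bspec[OF f(4)[unfolded lifts_def] F(1)] z] F(2) obtain G where
      G: "G \<in> Hol unit_disk" "G 0 = z" "\<And>z. z \<in> unit_disk \<Longrightarrow> f (G z) = F z" by auto
    have "circle_mean (\<lambda>z. cmod (F z) powr p) r \<le> Re (K (G 0))"
      by (rule circle_mean_le_harmonic[OF f(1) p K(1) _ F(1) G(1,3) r]) (use K(2) k(3) in simp)
    thus ?thesis by (simp add: x G(2))
  qed
  \<comment> \<open>This bound gives a first majorant, used only to show that the set of means is
    bounded. The means of \<open>f\<close> are then at most the supremum, which replaces
    \<open>M\<close> and yields a majorant that is sharp at 0.\<close>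
  obtain M where M: "\<And>r. 0 < r \<Longrightarrow> r < 1 \<Longrightarrow> circle_mean (\<lambda>z. cmod (f z) powr p) r \<le> M"
    using hardy_space_circle_mean_bound[of f p] f(1) H p by blast
  obtain K0 where K0: "K0 holomorphic_on unit_disk" "\<And>z. z \<in> unit_disk \<Longrightarrow> cmod (k z) \<le> Re (K0 z)"
    by (rule ex_harmonic_majorant[OF k(1,2), of M]) (use M km in auto)
  have bdd: "bdd_above {circle_mean (\<lambda>z. cmod (F z) powr p) r | F r. F \<in> Hol D \<and> F 0 = w \<and> 0 < r \<and> r < 1}"
    using bound[OF K0, of 0] unfolding f(2) by (intro bdd_aboveI[of _ "Re (K0 0)"]) simp
  have means: "circle_mean (\<lambda>z. cmod (k z)) r \<le> mean_envelope D p w" if r: "0 < r" "r < 1" for r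
    unfolding mean_envelope_def km[OF r] by (rule cSup_upper[OF _ bdd]) (use f(1,2) r in blast)
  obtain K where K: "K holomorphic_on unit_disk" "\<And>z. z \<in> unit_disk \<Longrightarrow> cmod (k z) \<le> Re (K z)"
    "Re (K 0) \<le> mean_envelope D p w"
    by (rule ex_harmonic_majorant[OF k(1,2) means]) blast+
  have "mean_envelope D p (f z) \<le> Re (K z)" if "z \<in> unit_disk" for z
    unfolding mean_envelope_def
    by (rule cSup_least[OF mean_envelope_nonempty[OF Hol_in[OF f(1) that]]]) (rule bound[OF K(1,2) that])
  with f(1-3) K(1,3) bdd show ?thesis using that by blast
qed

lemma mean_envelope_bdd_above:
  assumes D: "open D" "D \<subseteq> halfplane" and p: "0 < p" and H: "Hol D \<subseteq> hardy_space p" and w: "w \<in> D"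
  shows "bdd_above {circle_mean (\<lambda>z. cmod (F z) powr p) r | F r. F \<in> Hol D \<and> F 0 = w \<and> 0 < r \<and> r < 1}"
  by (rule mean_envelope_along_lift[OF assms])

lemma mean_envelope_ge:
  assumes "open D" "D \<subseteq> halfplane" "0 < p" "Hol D \<subseteq> hardy_space p" "w \<in> D"
  shows "cmod w powr p \<le> mean_envelope D p w"
  unfolding mean_envelope_def
proof (rule cSup_upper[OF _ mean_envelope_bdd_above[OF assms]])
  have "(\<lambda>_. w) \<in> Hol D" using assms(5) by (auto simp: Hol_def)
  moreover have "cmod w powr p = circle_mean (\<lambda>_. cmod w powr p) (1/2)"
    by (simp add: circle_mean_def)
  ultimately show "cmod w powr p \<in> {circle_mean (\<lambda>z. cmod (F z) powr p) r | F r. F \<in> Hol D \<and> F 0 = w \<and> 0 < r \<and> r < 1}"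
    by (intro CollectI exI[of _ "\<lambda>_. w"] exI[of _ "1/2::real"]) auto
qed

text \<open>Shrinking a competitor \<open>F\<close> to \<open>F (\<rho> * z)\<close> confines its
  image to a compact subset of \<open>D\<close>, so small translates of it compete at nearby base
  points. The radius \<open>r / \<rho>\<close> recovers the original mean, and the means depend
  continuously on the translation.\<close>

lemma mean_envelope_lower_semicontinuous:
  assumes D: "open D" "D \<subseteq> halfplane" and p: "0 < p" and H: "Hol D \<subseteq> hardy_space p" and w: "w \<in> D"
    and c: "c < mean_envelope D p w"
  shows "\<forall>\<^sub>F y in nhds w. c < mean_envelope D p y"
proof -
  obtain F r where F: "F \<in> Hol D" "F 0 = w" and r: "0 < r" "r < 1"
    and cF: "c < circle_mean (\<lambda>z. cmod (F z) powr p) r"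
    using less_cSupD[OF mean_envelope_nonempty[OF w] c[unfolded mean_envelope_def]] by blast
  define \<rho> where "\<rho> = (r + 1) / 2"
  have \<rho>: "r < \<rho>" "\<rho> < 1" "0 < \<rho>" using r by (auto simp: \<rho>_def)
  define F1 where "F1 = (\<lambda>z. F (of_real \<rho> * z))"
  have in_cball: "of_real \<rho> * z \<in> cball 0 \<rho>" if "z \<in> unit_disk" for z
    using \<rho> that by (simp add: norm_mult mult_le_cancel_left1)
  have sub: "cball 0 \<rho> \<subseteq> unit_disk" using \<rho> by auto
  have "compact (F ` cball 0 \<rho>)"
    by (intro compact_continuous_image holomorphic_on_imp_continuous_on
        holomorphic_on_subset[OF Hol_holomorphic[OF F(1)] sub] compact_cball)
  moreover have "F ` cball 0 \<rho> \<subseteq> D" using F(1) sub by (auto simp: Hol_def)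
  ultimately obtain e where e: "e > 0" "(\<Union>x\<in>F ` cball 0 \<rho>. ball x e) \<subseteq> D"
    using compact_subset_open_imp_ball_epsilon_subset[OF _ D(1)] by metis
  have F1h: "F1 holomorphic_on unit_disk"
  proof -
    have "(\<lambda>z. of_real \<rho> * z) \<in> Hol unit_disk"
      by (rule HolI) (use in_cball sub in \<open>blast intro: holomorphic_intros\<close>)+
    from Hol_holomorphic[OF Hol_compose[OF F(1) this]] show ?thesis by (simp add: F1_def)
  qed
  have shift: "(\<lambda>z. F1 z + v) \<in> Hol D" if v: "v \<in> ball 0 e" for v
  proof (rule HolI)
    fix z assume "z \<in> unit_disk"
    hence "F1 z \<in> F ` cball 0 \<rho>" unfolding F1_def using in_cball by blast
    moreover have "F1 z + v \<in> ball (F1 z) e" using v by (simp add: dist_norm)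
    ultimately show "F1 z + v \<in> D" using e(2) by blast
  qed (intro holomorphic_intros F1h)
  define s where "s = r / \<rho>"
  have s: "0 < s" "s < 1" "\<rho> * s = r" using r \<rho> by (auto simp: s_def)
  define h where "h = (\<lambda>v. circle_mean (\<lambda>z. cmod (F1 z + v) powr p) s)"
  have h0: "c < h 0"
    using cF unfolding h_def F1_def circle_mean_def s(3)[symmetric] by (simp add: mult.assoc)
  have "continuous_on (UNIV \<times> cbox 0 (2 * pi)) (\<lambda>(v, t). cmod (F1 (of_real s * cis t) + v) powr p)"
  proof -
    have "continuous_on UNIV (\<lambda>t. F1 (of_real s * cis t))"
      by (intro continuous_on_circle continuous_on_circle_sphere F1h s)
    hence "continuous_on (UNIV \<times> cbox 0 (2 * pi)) (\<lambda>x :: complex \<times> real. F1 (of_real s * cis (snd x)))"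
      by (rule continuous_on_compose2) (auto intro!: continuous_intros)
    thus ?thesis unfolding case_prod_unfold
      by (intro continuous_on_norm_powr[OF _ p] continuous_intros)
  qed
  from integral_continuous_on_param[OF this]
  have "continuous_on UNIV h" unfolding h_def circle_mean_def by (auto intro!: continuous_intros)
  hence "(h \<longlongrightarrow> h 0) (nhds 0)"
    by (simp add: continuous_on_eq_continuous_at isCont_def tendsto_at_iff_tendsto_nhds)
  hence "\<forall>\<^sub>F v in nhds 0. c < h v" using h0 by (rule order_tendstoD)
  moreover have "\<forall>\<^sub>F v in nhds 0. v \<in> ball 0 e" by (rule eventually_nhds_in_open) (use e in auto)
  moreover have "\<forall>\<^sub>F v in nhds 0. w + v \<in> D"
  proof -
    have "((\<lambda>v. w + v) \<longlongrightarrow> w + 0) (nhds 0)" by (intro tendsto_intros filterlim_ident)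
    thus ?thesis using topological_tendstoD[OF _ D(1)] w by auto
  qed
  ultimately have "\<forall>\<^sub>F v in nhds 0. c < mean_envelope D p (w + v)"
  proof eventually_elim
    case (elim v)
    have "h v \<le> mean_envelope D p (w + v)"
      unfolding mean_envelope_def
    proof (rule cSup_upper[OF _ mean_envelope_bdd_above[OF D p H elim(3)]])
      have "F1 0 + v = w + v" by (simp add: F1_def F(2))
      thus "h v \<in> {circle_mean (\<lambda>z. cmod (F z) powr p) r | F r. F \<in> Hol D \<and> F 0 = w + v \<and> 0 < r \<and> r < 1}"
        unfolding h_def using shift[OF elim(2)] s
        by (intro CollectI exI[of _ "\<lambda>z. F1 z + v"] exI[of _ s]) auto
    qed
    with elim(1) show ?case by simp
  qed
  moreover have "filterlim (\<lambda>y. y - w) (nhds 0) (nhds w)"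
    using tendsto_diff[OF filterlim_ident tendsto_const, of w w] by simp
  ultimately have "\<forall>\<^sub>F y in nhds w. c < mean_envelope D p (w + (y - w))"
    by (rule eventually_compose_filterlim)
  thus ?thesis by simp
qed

section \<open>The minimum principle on the truncated half-plane\<close>

text \<open>If every \<open>x\<close> were beaten by some \<open>Y x\<close>, then near
  \<open>x\<close> all values would exceed \<open>q (Y x)\<close>. By compactness finitely many
  \<open>Y x\<close> suffice, and the best of these would be beaten by another one.\<close>

lemma lower_semicontinuous_attains_inf:
  fixes q :: "'a::metric_space \<Rightarrow> real"
  assumes C: "compact C" "C \<noteq> {}"
    and lsc: "\<And>x c. x \<in> C \<Longrightarrow> c < q x \<Longrightarrow> \<forall>\<^sub>F y in at x within C. c < q y"
  shows "\<exists>x\<in>C. \<forall>y\<in>C. q x \<le> q y"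
proof (rule ccontr)
  assume "\<not> (\<exists>x\<in>C. \<forall>y\<in>C. q x \<le> q y)"
  hence "\<forall>x\<in>C. \<exists>y\<in>C. q y < q x" by (meson not_le)
  then obtain Y where Y: "\<And>x. x \<in> C \<Longrightarrow> Y x \<in> C" "\<And>x. x \<in> C \<Longrightarrow> q (Y x) < q x" by metis
  have "\<exists>U. open U \<and> x \<in> U \<and> (\<forall>y\<in>U \<inter> C. q (Y x) < q y)" if x: "x \<in> C" for x
  proof -
    obtain U where "open U" "x \<in> U" "\<forall>y\<in>U. y \<noteq> x \<longrightarrow> y \<in> C \<longrightarrow> q (Y x) < q y"
      using lsc[OF x Y(2)[OF x]] unfolding eventually_at_topological by blast
    thus ?thesis using Y(2)[OF x] by (intro exI[of _ U]) auto
  qed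

  hence "\<forall>x\<in>C. \<exists>U. open U \<and> x \<in> U \<and> (\<forall>y\<in>U \<inter> C. q (Y x) < q y)" by blast
  from bchoice[OF this] obtain U where U: "\<And>x. x \<in> C \<Longrightarrow> open (U x)" "\<And>x. x \<in> C \<Longrightarrow> x \<in> U x"
    "\<And>x y. x \<in> C \<Longrightarrow> y \<in> U x \<Longrightarrow> y \<in> C \<Longrightarrow> q (Y x) < q y" by blast
  obtain C' where C': "C' \<subseteq> C" "finite C'" "C \<subseteq> (\<Union>x\<in>C'. U x)"
    by (rule compactE_image[OF C(1), of C U]) (use U in auto)
  have ne: "C' \<noteq> {}" using C' C(2) by auto
  define m where "m = Min ((\<lambda>x. q (Y x)) ` C')"
  have "m \<in> (\<lambda>x. q (Y x)) ` C'" unfolding m_def using C'(2) ne by (intro Min_in) auto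
  then obtain x where x: "x \<in> C'" "m = q (Y x)" by blast
  have "Y x \<in> C" using x C' Y by blast
  then obtain x' where x': "x' \<in> C'" "Y x \<in> U x'" using C'(3) by blast
  have "q (Y x') < q (Y x)" using U(3)[of x' "Y x"] x' C'(1) \<open>Y x \<in> C\<close> by blast
  moreover have "m \<le> q (Y x')" unfolding m_def using C'(2) x' by (intro Min_le) auto
  ultimately show False using x by simp
qed

text \<open>The modulus of \<open>exp (- J z)\<close> has a local maximum at 0, so
  \<open>Re J\<close> is constant; the quadratic term then leaves \<open>f\<close> no room to vary
  near 0.\<close>

lemma Re_local_min_imp_constant:
  assumes J: "J holomorphic_on unit_disk" and f: "f holomorphic_on unit_disk" and e: "e > 0" and d: "d > 0" "d \<le> 1"
    and min: "\<And>z. cmod z < d \<Longrightarrow> Re (J 0) + e * (cmod (f z - f 0))\<^sup>2 \<le> Re (J z)"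
  shows "deriv f 0 = 0"
proof -
  have sub: "ball 0 d \<subseteq> unit_disk" using d by auto
  have "(\<lambda>z. exp (- J z)) constant_on unit_disk"
  proof (rule maximum_modulus_principle[OF _ open_ball connected_ball open_ball sub])
    show "(\<lambda>z. exp (- J z)) holomorphic_on unit_disk" by (intro holomorphic_intros J)
    show "0 \<in> ball (0::complex) d" using d by simp
    show "cmod (exp (- J z)) \<le> cmod (exp (- J 0))" if "z \<in> ball 0 d" for z
    proof -
      have "0 \<le> e * (cmod (f z - f 0))\<^sup>2" using e by simp
      thus ?thesis using min[of z] that by simp
    qed
  qed
  then obtain c where c: "\<And>z. z \<in> unit_disk \<Longrightarrow> exp (- J z) = c" unfolding constant_on_def by blast
  have "f z = f 0" if z: "z \<in> ball 0 d" for z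
  proof -
    have "z \<in> unit_disk" using z sub by blast
    hence "exp (- J z) = exp (- J 0)" using c[of z] c[of 0] by simp
    hence "cmod (exp (- J z)) = cmod (exp (- J 0))" by simp
    hence "Re (J z) = Re (J 0)" by simp
    hence "e * (cmod (f z - f 0))\<^sup>2 \<le> 0" using min[of z] z by simp
    thus ?thesis using e by (simp add: mult_le_0_iff)
  qed
  note const = this
  have "(f has_field_derivative 0) (at 0)"
  proof (rule has_field_derivative_transform_within_open[OF DERIV_const])
    show "open (ball (0::complex) d)" by (rule open_ball)
    show "f 0 = f z" if "z \<in> ball 0 d" for z using const[OF that] by simp
  qed (use d in simp)
  thus ?thesis by (rule DERIV_imp_deriv)
qed

lemma norm_diff_square: "(cmod (a - b))\<^sup>2 = (cmod a)\<^sup>2 + (cmod b)\<^sup>2 - 2 * Re (cnj b * a)"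
  unfolding cmod_power2 by (simp add: power2_eq_square algebra_simps)

text \<open>A small multiple of the logarithmic potential in \<open>v\<close>, which is infinite at the dyadic points, makes
  these points invisible to the minimum principle. The term \<open>R\<^sup>2 - \<bar>w\<bar>\<^sup>2\<close> is strictly superharmonic and
  rules out the equality case of the minimum principle.\<close>

lemma mean_envelope_ge_linear_aux:
  fixes R p :: real
  defines "T \<equiv> dyadic \<inter> {w. 1 \<le> Re w \<and> cmod w \<le> R}"
  defines "v \<equiv> \<lambda>w. (\<Sum>s\<in>T. ln (2 * R / cmod (w - s))) + R\<^sup>2 - (cmod w)\<^sup>2"
  assumes p: "1 \<le> p" and H: "Hol punctured_halfplane \<subseteq> hardy_space p" and R: "0 < R"
    and e: "0 < e" and w1: "w1 \<in> punctured_halfplane" "1 \<le> Re w1" "cmod w1 \<le> R"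
  shows "R powr (p - 1) * (Re w1 - 1) \<le> mean_envelope punctured_halfplane p w1 + e * v w1"
proof (rule ccontr)
  let ?D = punctured_halfplane
  let ?u = "mean_envelope ?D p"
  define A where "A = {w \<in> ?D. 1 \<le> Re w \<and> cmod w \<le> R}"
  define q where "q = (\<lambda>w. ?u w + (e * v w - R powr (p - 1) * (Re w - 1)))"
  assume "\<not> ?thesis"
  hence q1: "q w1 < 0" by (simp add: q_def)
  have p0: "0 < p" using p by simp
  note D = open_punctured_halfplane punctured_halfplane_subset p0 H
  have finT: "finite T" unfolding T_def by (rule finite_dyadic_Int) simp
  have u_ge: "cmod w powr p \<le> ?u w" if "w \<in> ?D" for w by (rule mean_envelope_ge[OF D that])
  have u_nonneg: "0 \<le> ?u w" if "w \<in> ?D" for w using order_trans[OF powr_ge_zero u_ge[OF that]] .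
  have AT: "w \<noteq> s" if "w \<in> A" "s \<in> T" for w s
    using that by (auto simp: A_def T_def punctured_halfplane_def)
  have ln_nonneg: "0 \<le> ln (2 * R / cmod (w - s))" if "w \<in> A" "s \<in> T" for w s
  proof -
    have "cmod (w - s) \<le> 2 * R" using norm_triangle_ineq4[of w s] that by (auto simp: A_def T_def)
    moreover have "0 < cmod (w - s)" using AT[OF that] by simp
    ultimately show ?thesis by (intro ln_ge_zero) (simp add: le_divide_eq)
  qed
  have sq_nonneg: "0 \<le> R\<^sup>2 - (cmod w)\<^sup>2" if "w \<in> A" for w
    using that R by (auto simp: A_def intro!: power_mono)
  have v_nonneg: "0 \<le> v w" if "w \<in> A" for w
    using sum_nonneg[of T "\<lambda>s. ln (2 * R / cmod (w - s))"] ln_nonneg[OF that] sq_nonneg[OF that]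
    unfolding v_def by (simp add: add_nonneg_nonneg)
  define B where "B = R powr (p - 1) * R"
  have B_ge: "R powr (p - 1) * (Re w - 1) \<le> B" if "w \<in> A" for w
    unfolding B_def using that complex_Re_le_cmod[of w] by (intro mult_left_mono) (auto simp: A_def)
  \<comment> \<open>Within this distance of a puncture, its single logarithmic term times
    \<open>e\<close> already reaches \<open>B\<close>, an upper bound for the linear function on
    \<open>A\<close>.\<close>
  define \<sigma> where "\<sigma> = 2 * R * exp (- B / e)"
  have \<sigma>: "0 < \<sigma>" using R by (simp add: \<sigma>_def)
  have near: "0 \<le> q w" if w: "w \<in> A" and s: "s \<in> T" and "cmod (w - s) < \<sigma>" for w s
  proof -
    have pos: "0 < cmod (w - s)" using AT[OF w s] by simp
    have "exp (B / e) * cmod (w - s) \<le> exp (B / e) * \<sigma>"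
      using that(3) by (intro mult_left_mono) auto
    also have "\<dots> = 2 * R" by (simp add: \<sigma>_def exp_minus field_simps)
    finally have "exp (B / e) \<le> 2 * R / cmod (w - s)" using pos by (simp add: le_divide_eq)
    hence "B / e \<le> ln (2 * R / cmod (w - s))" using pos R by (simp add: ln_ge_iff)
    also have "\<dots> \<le> (\<Sum>s\<in>T. ln (2 * R / cmod (w - s)))"
      by (rule member_le_sum[OF s _ finT]) (use ln_nonneg[OF w] in auto)
    also have "\<dots> \<le> v w" using sq_nonneg[OF w] by (simp add: v_def)
    finally have "B \<le> e * v w" using e by (simp add: field_simps)
    thus ?thesis using u_nonneg[of w] w B_ge[OF w] by (auto simp: q_def A_def)
  qed
  \<comment> \<open>Unlike \<open>A\<close>, this set is compact. Since \<open>q\<close> is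
    nonnegative on the removed discs, a negative minimum over \<open>C\<close> is a minimum over
    \<open>A\<close>.\<close>
  define C where "C = {w. 1 \<le> Re w} \<inter> cball 0 R \<inter> (\<Inter>s\<in>T. - ball s \<sigma>)"
  have "compact C"
    unfolding C_def by (intro closed_Int_compact compact_Int_closed closed_INT ballI compact_cball closed_halfspace_Re_ge)
       (auto simp: closed_def)
  have CA: "C \<subseteq> A"
  proof
    fix w assume w: "w \<in> C"
    have "w \<notin> dyadic"
    proof
      assume "w \<in> dyadic"
      hence "w \<in> T" using w by (auto simp: C_def T_def)
      thus False using w \<sigma> by (auto simp: C_def)
    qed
    thus "w \<in> A" using w by (auto simp: C_def A_def punctured_halfplane_def halfplane_def)
  qed
  have inC: "w \<in> C" if "w \<in> A" "q w < 0" for w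
    using that near[OF that(1)] by (force simp: C_def A_def dist_norm norm_minus_commute)
  have w1C: "w1 \<in> C" by (rule inC[OF _ q1]) (use w1 in \<open>auto simp: A_def\<close>)
  have cont: "continuous_on C (\<lambda>w. e * v w - R powr (p - 1) * (Re w - 1))"
    unfolding v_def using AT CA R by (intro continuous_intros) auto
  have "\<exists>w0\<in>C. \<forall>y\<in>C. q w0 \<le> q y"
  proof (rule lower_semicontinuous_attains_inf[OF \<open>compact C\<close>])
    show "C \<noteq> {}" using w1C by blast
    fix x c assume x: "x \<in> C" and c: "c < q x"
    define g where "g = (\<lambda>w. e * v w - R powr (p - 1) * (Re w - 1))"
    define d where "d = (q x - c) / 2"
    have d: "0 < d" using c by (simp add: d_def)
    have "x \<in> ?D" using x CA by (auto simp: A_def)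
    have "\<forall>\<^sub>F y in nhds x. ?u x - d < ?u y"
      by (rule mean_envelope_lower_semicontinuous[OF D \<open>x \<in> ?D\<close>]) (use d in simp)
    hence "\<forall>\<^sub>F y in at x within C. ?u x - d < ?u y"
      by (rule filter_leD[rotated]) (simp add: at_within_def)
    moreover have "(g \<longlongrightarrow> g x) (at x within C)"
      using cont x unfolding g_def continuous_on_def by blast
    hence "\<forall>\<^sub>F y in at x within C. g x - d < g y" by (rule order_tendstoD) (use d in simp)
    ultimately show "\<forall>\<^sub>F y in at x within C. c < q y"
    proof eventually_elim
      case (elim y)
      have "c = (?u x - d) + (g x - d)" by (simp add: d_def q_def g_def field_simps)
      also have "\<dots> < ?u y + g y" using elim by (rule add_strict_mono)
      finally show ?case by (simp add: q_def g_def)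
    qed
  qed
  then obtain w0 where w0: "w0 \<in> C" "\<And>y. y \<in> C \<Longrightarrow> q w0 \<le> q y" by blast
  have q0: "q w0 < 0" using w0(2)[OF w1C] q1 by simp
  have w0A: "w0 \<in> A" using w0(1) CA by blast
  hence w0D: "w0 \<in> ?D" by (simp add: A_def)
  have minA: "q w0 \<le> q y" if "y \<in> A" for y
    using inC[OF that] w0(2)[of y] q0 by fastforce
  \<comment> \<open>On this part of the boundary the linear function vanishes, while the envelope
    and \<open>v\<close> are nonnegative.\<close>
  have "Re w0 \<noteq> 1"
    using q0 u_nonneg[OF w0D] mult_nonneg_nonneg[OF less_imp_le[OF e] v_nonneg[OF w0A]] by (auto simp: q_def)
  hence Re_w0: "1 < Re w0" using w0A by (simp add: A_def)
  \<comment> \<open>On the arc the lower bound from constant maps gives \<open>R powr p\<close>,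
    which equals \<open>B\<close>.\<close>
  have "cmod w0 \<noteq> R"
  proof
    assume "cmod w0 = R"
    hence "R powr (p - 1) * R \<le> ?u w0" using u_ge[OF w0D] R by (simp add: powr_diff)
    moreover have "0 \<le> e * v w0" using e v_nonneg[OF w0A] by simp
    ultimately show False using q0 B_ge[OF w0A] by (simp add: q_def B_def)
  qed
  hence norm_w0: "cmod w0 < R" using w0A by (simp add: A_def)
  obtain f K where f: "f \<in> Hol ?D" "f 0 = w0" "deriv f 0 \<noteq> 0" and K: "K holomorphic_on unit_disk"
    "Re (K 0) \<le> ?u w0" "\<And>z. z \<in> unit_disk \<Longrightarrow> ?u (f z) \<le> Re (K z)"
    by (rule mean_envelope_along_lift[OF D w0D]) blast
  have fh: "f holomorphic_on unit_disk" by (rule Hol_holomorphic[OF f(1)])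
  \<comment> \<open>Since \<open>f\<close> omits \<open>s\<close>, the potential pulled back along
    \<open>f\<close> is the real part of a holomorphic function.\<close>
  have "\<exists>L. L holomorphic_on unit_disk \<and> (\<forall>z\<in>unit_disk. exp (L z) = f z - s)" if "s \<in> T" for s
  proof -
    have nz: "f z - s \<noteq> 0" if "z \<in> unit_disk" for z
      using Hol_in[OF f(1) that] \<open>s \<in> T\<close> by (auto simp: T_def punctured_halfplane_def)
    have hol: "(\<lambda>z. f z - s) holomorphic_on unit_disk" by (intro holomorphic_intros fh)
    show ?thesis
      by (rule holomorphic_logarithm_exists[OF convex_ball open_ball hol nz, of 0]) auto
  qed
  then obtain L where L: "\<And>s. s \<in> T \<Longrightarrow> L s holomorphic_on unit_disk"
    "\<And>s z. s \<in> T \<Longrightarrow> z \<in> unit_disk \<Longrightarrow> exp (L s z) = f z - s" by metis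
  have ReL: "ln (2 * R / cmod (f z - s)) = ln (2 * R) - Re (L s z)" if "s \<in> T" "z \<in> unit_disk" for s z
  proof -
    have "cmod (f z - s) = exp (Re (L s z))" using L(2)[OF that] by (metis norm_exp_eq_Re)
    thus ?thesis using R by (simp add: ln_div)
  qed
  \<comment> \<open>Of the terms of \<open>q\<close> along \<open>f\<close>, only
    \<open>- |f|^2\<close> fails to be the real part of a holomorphic function. Adding
    \<open>|f - w0|^2\<close> leaves \<open>|w0|^2 - 2 * Re (cnj w0 * f)\<close>, and the added
    square is the strict term in the minimum argument.\<close>
  define J where "J = (\<lambda>z. K z + of_real e * ((\<Sum>s\<in>T. of_real (ln (2 * R)) - L s z) +
      of_real (R\<^sup>2 + (cmod w0)\<^sup>2) - 2 * cnj w0 * f z) - of_real (R powr (p - 1)) * (f z - 1))"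
  have J: "J holomorphic_on unit_disk"
    unfolding J_def by (intro holomorphic_intros K fh L(1))
  have ReJ: "Re (J z) = Re (K z) + (e * v (f z) - R powr (p - 1) * (Re (f z) - 1)) + e * (cmod (f z - w0))\<^sup>2"
    if "z \<in> unit_disk" for z
  proof -
    have "v (f z) + (cmod (f z - w0))\<^sup>2 = Re ((\<Sum>s\<in>T. of_real (ln (2 * R)) - L s z) +
      of_real (R\<^sup>2 + (cmod w0)\<^sup>2) - 2 * cnj w0 * f z)"
      unfolding v_def norm_diff_square using ReL[OF _ that] by (simp add: mult.assoc)
    from arg_cong[OF this, of "\<lambda>x. e * x"] show ?thesis
      unfolding J_def by (simp add: algebra_simps)
  qed
  have "isCont f 0"
    using holomorphic_on_imp_continuous_on[OF fh] by (simp add: continuous_on_eq_continuous_at)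
  hence "(f \<longlongrightarrow> f 0) (nhds 0)" by (simp add: isCont_def tendsto_at_iff_tendsto_nhds)
  hence "(f \<longlongrightarrow> w0) (nhds 0)" by (simp only: f(2))
  moreover have "open ({w. 1 < Re w} \<inter> ball 0 R)" by (intro open_Int open_ball open_halfspace_Re_gt)
  moreover have "w0 \<in> {w. 1 < Re w} \<inter> ball 0 R" using Re_w0 norm_w0 by simp
  ultimately have "\<forall>\<^sub>F z in nhds 0. f z \<in> {w. 1 < Re w} \<inter> ball 0 R" by (rule topological_tendstoD)
  then obtain d0 where d0: "d0 > 0" "\<And>z. cmod z < d0 \<Longrightarrow> f z \<in> {w. 1 < Re w} \<inter> ball 0 R"
    unfolding eventually_nhds_metric by auto
  define d where "d = min d0 1"
  have "deriv f 0 = 0"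
  proof (rule Re_local_min_imp_constant[OF J fh e, of d])
    fix z assume z: "cmod z < d"
    hence zd: "z \<in> unit_disk" by (simp add: d_def)
    have "f z \<in> A" using d0(2)[of z] z Hol_in[OF f(1) zd] by (auto simp: A_def d_def)
    have "Re (J 0) \<le> q w0" using ReJ[of 0] K(2) by (simp add: f(2) q_def)
    also have "\<dots> \<le> q (f z)" by (rule minA[OF \<open>f z \<in> A\<close>])
    also have "\<dots> \<le> Re (J z) - e * (cmod (f z - w0))\<^sup>2"
      using ReJ[OF zd] K(3)[OF zd] by (simp add: q_def)
    finally show "Re (J 0) + e * (cmod (f z - f 0))\<^sup>2 \<le> Re (J z)" by (simp add: f(2))
  qed (use d0(1) in \<open>auto simp: d_def\<close>)
  with f(3) show False by blast
qed

text \<open>At a fixed point off the punctures the penalty is a finite number, so its coefficient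
  can tend to 0.\<close>

lemma mean_envelope_ge_linear:
  assumes p: "1 \<le> p" and H: "Hol punctured_halfplane \<subseteq> hardy_space p"
    and w: "w \<in> punctured_halfplane" "1 \<le> Re w" "cmod w \<le> R"
  shows "R powr (p - 1) * (Re w - 1) \<le> mean_envelope punctured_halfplane p w"
proof (rule field_le_epsilon)
  fix d :: real assume d: "0 < d"
  define x where "x = (\<Sum>s\<in>dyadic \<inter> {w. 1 \<le> Re w \<and> cmod w \<le> R}. ln (2 * R / cmod (w - s))) + R\<^sup>2 - (cmod w)\<^sup>2"
  define e where "e = d / (\<bar>x\<bar> + 1)"
  have "0 < R" using w complex_Re_le_cmod[of w] by linarith
  moreover have "0 < e" using d by (simp add: e_def add_nonneg_pos)
  ultimately have "R powr (p - 1) * (Re w - 1) \<le> mean_envelope punctured_halfplane p w + e * x"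
    unfolding x_def by (intro mean_envelope_ge_linear_aux p H w)
  also have "e * x \<le> e * (\<bar>x\<bar> + 1)" using \<open>0 < e\<close> by (intro mult_left_mono) auto
  also have "\<dots> = d" by (simp add: e_def)
  finally show "R powr (p - 1) * (Re w - 1) \<le> mean_envelope punctured_halfplane p w + d" by simp
qed

theorem punctured_halfplane_not_hardy:
  assumes "1 < p"
  shows "\<not> Hol punctured_halfplane \<subseteq> hardy_space p"
proof
  assume H: "Hol punctured_halfplane \<subseteq> hardy_space p"
  \<comment> \<open>Off the real axis, hence not dyadic, and with \<open>Re w - 1 = 1\<close>, so
    that the linear bound reads \<open>R powr (p - 1) \<le> u\<close>.\<close>
  define w where "w = Complex 2 1"
  have w: "w \<in> punctured_halfplane" unfolding w_def by (rule in_punctured_halfplaneI) auto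
  define u where "u = mean_envelope punctured_halfplane p w"
  \<comment> \<open>Solves \<open>S powr (p - 1) = |u| + 1\<close>, which exceeds \<open>u\<close>;
    this uses \<open>p > 1\<close>.\<close>
  define S where "S = (\<bar>u\<bar> + 1) powr (1 / (p - 1))"
  define R where "R = max (cmod w) S"
  have "R powr (p - 1) * (Re w - 1) \<le> u"
    unfolding u_def by (rule mean_envelope_ge_linear[OF _ H w]) (use assms in \<open>auto simp: w_def R_def\<close>)
  hence "R powr (p - 1) \<le> u" by (simp add: w_def)
  moreover have "S powr (p - 1) \<le> R powr (p - 1)"
    using assms by (intro powr_mono2) (auto simp: R_def S_def)
  moreover have "S powr (p - 1) = \<bar>u\<bar> + 1"
    using assms by (simp add: S_def powr_powr)
  ultimately show False by linarith
qed

section \<open>Growth of maps into the punctured half-plane\<close>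

text \<open>The maximum of \<open>t * ln (1 / t)\<close> is \<open>1 / e\<close>, at most 2/5, so
  the left side is at most 4/5. The right side is at least \<open>31/32 * 55/64\<close>, about
  0.83.\<close>

lemma two_t_ln_inverse_le:
  fixes t :: real
  assumes "0 < t" "t\<^sup>2 \<le> 9 / 64"
  shows "2 * t * ln (1 / t) \<le> 31 / 32 * (1 - t\<^sup>2)"
proof -
  have e: "5 / 2 \<le> exp (1 :: real)" using exp_lower_Taylor_quadratic[of 1] by simp
  have "ln (1 / t) - 1 = ln (1 / t / exp 1)" using assms by (simp add: ln_div ln_mult)
  also have "\<dots> \<le> 1 / t / exp 1 - 1" using assms by (intro ln_le_minus_one) simp
  finally have "t * ln (1 / t) \<le> t * (1 / t / exp 1)" using assms by (intro mult_left_mono) auto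
  also have "\<dots> = 1 / exp 1" using assms by simp
  also have "\<dots> \<le> 1 / (5 / 2)" using e by (intro divide_left_mono) auto
  finally show ?thesis using assms(2) by simp
qed

text \<open>Away from the positive axis the Schwarz--Pick lemma for the half-plane is not sharp in terms of
  \<open>\<bar>F 0\<bar>\<close>; near it an omitted dyadic point within bounded hyperbolic distance improves it.\<close>

lemma punctured_halfplane_deriv_bound:
  assumes F: "F \<in> Hol punctured_halfplane"
  shows "cmod (deriv F 0) \<le> 2 * (31 / 32) * cmod (F 0)"
proof -
  define w where "w = F 0"
  have FH: "F \<in> Hol halfplane" by (rule Hol_mono[OF F punctured_halfplane_subset])
  have w: "0 < Re w" using Hol_in[OF FH, of 0] by (simp add: w_def halfplane_def)
  have SP: "cmod (deriv F 0) \<le> 2 * Re w" unfolding w_def by (rule Schwarz_Pick_halfplane[OF FH])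
  show ?thesis
  proof (cases "Re w \<le> 31 / 32 * cmod w")
    case True
    thus ?thesis using SP by (simp add: w_def)
  next
    case False
    define m where "m = cmod w"
    have m: "0 < m" using w by (auto simp: m_def)
    \<comment> \<open>The puncture \<open>s\<close> is the largest power of 2 not exceeding
      \<open>|w|\<close>, so \<open>|w|\<close> and \<open>s\<close> agree up to a factor 2.\<close>
    define n where "n = \<lfloor>log 2 m\<rfloor>"
    define s where "s = (2::real) powr of_int n"
    have s: "0 < s" by (simp add: s_def)
    have "s \<le> 2 powr (log 2 m)" unfolding s_def n_def by (intro powr_mono) auto
    hence sm: "s \<le> m" using m by simp
    have "2 powr (log 2 m) \<le> 2 powr (of_int n + 1)" unfolding n_def by (intro powr_mono) linarith+
    hence ms: "m \<le> 2 * s" using m by (simp add: s_def powr_add)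
    \<comment> \<open>The Cayley transform centred at the puncture sends it to 0, so
      \<open>g\<close> omits 0 and the punctured-disc bound applies.\<close>
    define g where "g = (\<lambda>z. of_halfplane (of_real s) (F z))"
    have sre: "0 < Re (of_real s)" using s by simp
    have gH: "g \<in> Hol unit_disk"
      unfolding g_def
      by (rule Hol_compose_holomorphic[OF of_halfplane_holomorphic[OF sre] FH of_halfplane_in_ball[OF sre]])
    have gnz: "g z \<noteq> 0" if "z \<in> unit_disk" for z
    proof -
      have "F z \<noteq> of_real s" using Hol_in[OF F that] by (auto simp: punctured_halfplane_def dyadic_def s_def)
      moreover have "F z + of_real s \<noteq> 0"
        using Hol_in[OF FH that] s by (auto simp: halfplane_def complex_eq_iff)
      ultimately show ?thesis by (simp add: g_def of_halfplane_def)
    qed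
    have g: "g \<in> Hol (unit_disk - {0})"
      by (rule HolI[OF Hol_holomorphic[OF gH]]) (use Hol_in[OF gH] gnz in blast)
    define t where "t = cmod (g 0)"
    have t: "0 < t" using Hol_in[OF g, of 0] by (simp add: t_def)
    have ws: "w + of_real s \<noteq> 0" using w s by (auto simp: complex_eq_iff)
    have "((\<lambda>z. F z - of_real s) has_field_derivative deriv F 0) (at 0)"
      "((\<lambda>z. F z + of_real s) has_field_derivative deriv F 0) (at 0)"
      by (auto intro!: derivative_eq_intros Hol_field_derivative[OF F])
    from DERIV_divide[OF this] ws
    have "(g has_field_derivative (deriv F 0 * (w + of_real s) - (w - of_real s) * deriv F 0) /
        ((w + of_real s) * (w + of_real s))) (at 0)"
      by (simp add: g_def of_halfplane_def w_def)
    hence "deriv g 0 = (deriv F 0 * (w + of_real s) - (w - of_real s) * deriv F 0) /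
        ((w + of_real s) * (w + of_real s))" by (rule DERIV_imp_deriv)
    also have "deriv F 0 * (w + of_real s) - (w - of_real s) * deriv F 0 = deriv F 0 * of_real (2 * s)"
      by (simp add: algebra_simps)
    finally have g': "cmod (deriv g 0) = cmod (deriv F 0) * (2 * s) / (cmod (w + of_real s))\<^sup>2"
      using s by (simp add: norm_mult norm_divide power2_eq_square)
    define N where "N = (cmod (w + of_real s))\<^sup>2"
    have N: "0 < N" using ws by (simp add: N_def)
    have "t\<^sup>2 = (cmod (w - of_real s))\<^sup>2 / N"
      by (simp add: t_def g_def of_halfplane_def w_def N_def norm_divide power_divide)
    moreover have "(cmod (w - of_real s))\<^sup>2 = N - 4 * s * Re w"
      unfolding N_def cmod_power2 by (simp add: power2_eq_square algebra_simps)
    ultimately have t2: "1 - t\<^sup>2 = 4 * s * Re w / N" using N by (simp add: diff_divide_distrib)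
    have "sqrt N \<le> m + s" unfolding N_def m_def using norm_triangle_ineq[of w "of_real s"] s by simp
    hence "N \<le> (m + s)\<^sup>2" using N by (simp add: real_sqrt_le_iff sqrt_le_D)
    moreover have "2 * (m + s)\<^sup>2 \<le> 9 * s * m"
    proof -
      \<comment> \<open>Expanded, this is the claim; the worst case is
        \<open>m = 2 * s\<close>.\<close>
      have "(2 * s - m) * (s - 2 * m) \<le> 0" using sm ms s by (intro mult_nonneg_nonpos) auto
      thus ?thesis by (simp add: power2_eq_square algebra_simps)
    qed
    moreover have "31 / 32 * (s * m) \<le> s * Re w" using False s by (simp add: m_def field_simps)
    \<comment> \<open>The arithmetic is \<open>55/64 * 9/2 \<le> 4 * 31/32\<close>, with little to
      spare. It amounts to \<open>t \<le> 3/8\<close>, small enough for the punctured disc to beat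
      the full disc by the factor 31/32.\<close>
    ultimately have "55 / 64 * N \<le> 4 * s * Re w" using N by linarith
    hence "55 / 64 \<le> 1 - t\<^sup>2" unfolding t2 using N by (simp add: le_divide_eq)
    hence tt: "2 * t * ln (1 / t) \<le> 31 / 32 * (1 - t\<^sup>2)" by (intro two_t_ln_inverse_le t) simp
    have "cmod (deriv F 0) * (2 * s) / N \<le> 2 * t * ln (1 / t)"
      using punctured_disc_deriv_bound[OF g] by (simp add: g' N_def t_def)
    also have "\<dots> \<le> 31 / 32 * (4 * s * Re w / N)" using tt t2 by simp
    finally have "cmod (deriv F 0) * (2 * s) \<le> 31 / 32 * (2 * Re w) * (2 * s)"
      using N by (simp add: divide_le_cancel field_simps)
    hence "cmod (deriv F 0) \<le> 31 / 32 * (2 * Re w)" using s by simp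
    also have "\<dots> \<le> 31 / 32 * (2 * cmod w)" using complex_Re_le_cmod[of w] by simp
    finally show ?thesis by (simp add: w_def)
  qed
qed

text \<open>The class of maps is invariant under precomposition with disc automorphisms, so the
  bound at 0 moves to every point; the factor \<open>1 - |z|^2\<close> is the derivative of the
  automorphism at 0, up to sign.\<close>

lemma punctured_halfplane_deriv_bound_disc:
  assumes F: "F \<in> Hol punctured_halfplane" and z: "z \<in> unit_disk"
  shows "cmod (deriv F z) * (1 - (cmod z)\<^sup>2) \<le> 31 / 16 * cmod (F z)"
proof -
  obtain \<phi> where \<phi>: "\<phi> \<in> Hol unit_disk" "\<phi> 0 = z"
    "(\<phi> has_field_derivative (- of_real (1 - (cmod z)\<^sup>2))) (at 0)"
    by (rule Moebius_involution[OF z]) blast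
  have "((\<lambda>x. F (\<phi> x)) has_field_derivative deriv F z * (- of_real (1 - (cmod z)\<^sup>2))) (at 0)"
    using DERIV_chain2[OF _ \<phi>(3), of F "deriv F z"] Hol_field_derivative[OF F z] by (simp add: \<phi>(2))
  hence "deriv (\<lambda>x. F (\<phi> x)) 0 = deriv F z * (- of_real (1 - (cmod z)\<^sup>2))" by (rule DERIV_imp_deriv)
  moreover have "(cmod z)\<^sup>2 \<le> 1" using z by (simp add: power_le_one)
  hence "cmod (deriv F z * (- of_real (1 - (cmod z)\<^sup>2))) = cmod (deriv F z) * (1 - (cmod z)\<^sup>2)"
    by (simp only: norm_mult norm_minus_cancel norm_of_real abs_of_nonneg diff_ge_0_iff_ge)
  ultimately show ?thesis
    using punctured_halfplane_deriv_bound[OF Hol_compose[OF F \<phi>(1)]] by (simp add: \<phi>(2))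
qed

text \<open>Along a radius the logarithm of \<open>|F|\<close> has derivative at most
  \<open>31/16 / (1 - t^2)\<close>, which is 31/32 times the derivative of
  \<open>ln ((1 + t) / (1 - t))\<close>.\<close>

lemma punctured_halfplane_growth:
  assumes F: "F \<in> Hol punctured_halfplane" and z: "z \<in> unit_disk"
  shows "cmod (F z) \<le> cmod (F 0) * ((1 + cmod z) / (1 - cmod z)) powr (31 / 32)"
proof (cases "z = 0")
  case False
  define \<zeta> where "\<zeta> = z / of_real (cmod z)"
  have \<zeta>: "cmod \<zeta> = 1" "of_real (cmod z) * \<zeta> = z" using False by (auto simp: \<zeta>_def norm_divide)
  have FH: "F \<in> Hol halfplane" by (rule Hol_mono[OF F punctured_halfplane_subset])
  \<comment> \<open>This is \<open>ln |F|\<close> along the radius, written through the complex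
    logarithm so that the chain rule applies.\<close>
  define L where "L = (\<lambda>t. Re (Ln (F (of_real t * \<zeta>))))"
  define g where "g = (\<lambda>t. L t - 31 / 32 * (ln (1 + t) - ln (1 - t)))"
  have zlt: "cmod z < 1" using z by simp
  have "g (cmod z) \<le> g 0"
  proof (rule DERIV_nonpos_imp_nonincreasing[OF norm_ge_zero])
    fix t assume t: "0 \<le> t" "t \<le> cmod z"
    define x where "x = of_real t * \<zeta>"
    have xt: "cmod x = t" using t \<zeta> by (simp add: x_def norm_mult)
    have x: "x \<in> unit_disk" using xt t zlt by simp
    have Fx: "0 < Re (F x)" using Hol_in[OF FH x] by (simp add: halfplane_def)
    hence Fx': "F x \<notin> \<real>\<^sub>\<le>\<^sub>0" "F x \<noteq> 0" by (auto simp: complex_nonpos_Reals_iff)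
    have "((\<lambda>y. Ln (F y)) has_field_derivative inverse (F x) * deriv F x) (at x)"
      by (rule DERIV_chain2[OF has_field_derivative_Ln[OF Fx'(1)] Hol_field_derivative[OF F x]])
    moreover have "((\<lambda>t. of_real t * \<zeta>) has_vector_derivative \<zeta>) (at t)"
      by (auto intro!: derivative_eq_intros)
    ultimately have "((\<lambda>t. Ln (F (of_real t * \<zeta>))) has_vector_derivative \<zeta> * (inverse (F x) * deriv F x)) (at t)"
      using field_vector_diff_chain_at[of "\<lambda>t. of_real t * \<zeta>" \<zeta> t "\<lambda>y. Ln (F y)"] by (simp add: x_def o_def)
    from bounded_linear.has_vector_derivative[OF bounded_linear_Re this]
    have "(L has_real_derivative Re (\<zeta> * (inverse (F x) * deriv F x))) (at t)"
      by (simp add: L_def has_real_derivative_iff_has_vector_derivative)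
    moreover have "((\<lambda>t. 31 / 32 * (ln (1 + t) - ln (1 - t))) has_real_derivative 31 / 32 * (1 / (1 + t) + 1 / (1 - t))) (at t)"
      using t zlt by (auto intro!: derivative_eq_intros)
    ultimately have "(g has_real_derivative Re (\<zeta> * (inverse (F x) * deriv F x)) - 31 / 32 * (1 / (1 + t) + 1 / (1 - t))) (at t)"
      unfolding g_def by (rule DERIV_diff)
    moreover have "Re (\<zeta> * (inverse (F x) * deriv F x)) \<le> 31 / 32 * (1 / (1 + t) + 1 / (1 - t))"
    proof -
      have "Re (\<zeta> * (inverse (F x) * deriv F x)) \<le> cmod (\<zeta> * (inverse (F x) * deriv F x))"
        by (rule complex_Re_le_cmod)
      also have "\<dots> = cmod (deriv F x) / cmod (F x)"
        by (simp add: norm_mult norm_inverse \<zeta>(1) divide_inverse)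
      also have "\<dots> \<le> 31 / 16 / (1 - t\<^sup>2)"
      proof -
        have "0 < 1 - t\<^sup>2" using t zlt by (simp add: power_less_one_iff)
        thus ?thesis using punctured_halfplane_deriv_bound_disc[OF F x] Fx'(2) by (simp add: xt field_simps)
      qed
      also have "31 / 16 / (1 - t\<^sup>2) = 31 / 32 * (2 / (1 - t\<^sup>2))" by (simp add: divide_simps)
      also have "2 / (1 - t\<^sup>2) = 1 / (1 + t) + 1 / (1 - t)"
      proof -
        have "1 - t\<^sup>2 = (1 + t) * (1 - t)" by (simp add: power2_eq_square algebra_simps)
        moreover have "1 + t \<noteq> 0" "1 - t \<noteq> 0" using t zlt by auto
        ultimately show ?thesis by (simp add: field_simps)
      qed
      finally show ?thesis .
    qed
    ultimately show "\<exists>y. (g has_real_derivative y) (at t) \<and> y \<le> 0" by (intro exI conjI) auto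
  qed
  moreover have pos: "1 + cmod z \<noteq> 0" by (metis add_pos_nonneg less_irrefl norm_ge_zero zero_less_one)
  moreover have nz: "F y \<noteq> 0" if "y \<in> unit_disk" for y using Hol_in[OF FH that] by (auto simp: halfplane_def)
  ultimately have "ln (cmod (F z)) \<le> ln (cmod (F 0)) + 31 / 32 * ln ((1 + cmod z) / (1 - cmod z))"
    using zlt pos nz[OF z] nz[of 0] by (simp add: g_def L_def \<zeta>(2) ln_div)
  hence "exp (ln (cmod (F z))) \<le> exp (ln (cmod (F 0)) + 31 / 32 * ln ((1 + cmod z) / (1 - cmod z)))"
    by simp
  moreover have "(1 + cmod z) / (1 - cmod z) \<noteq> 0"
    using zlt pos by simp
  ultimately show ?thesis using nz[OF z] nz[of 0] by (simp add: exp_add powr_def)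
qed simp

text \<open>With \<open>\<kappa> = 31/32\<close>, the weight \<open>\<alpha> = p * \<kappa>\<close> exactly compensates the growth, and \<open>p = 4 / (1 - \<kappa>) = 128\<close>
  makes \<open>p / (\<alpha> + 2)\<close> larger than 1.\<close>

lemma bergman_number_ge_punctured_halfplane:
  assumes F: "F \<in> Hol punctured_halfplane"
  shows "ereal (64 / 63) \<le> bergman_number F"
proof -
  have "F \<in> bergman_space 128 124"
  proof -
    define C where "C = cmod (F 0) powr 128 * 2 powr 124"
    have le: "cmod (F z) powr 128 * (1 - cmod z) powr 124 \<le> C" if z: "z \<in> unit_disk" for z
    proof -
      have z1: "0 < 1 - cmod z" using z by simp
      have "cmod (F z) powr 128 \<le> (cmod (F 0) * ((1 + cmod z) / (1 - cmod z)) powr (31 / 32)) powr 128"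
        by (intro powr_mono2 punctured_halfplane_growth F z) auto
      also have "\<dots> = cmod (F 0) powr 128 * ((1 + cmod z) / (1 - cmod z)) powr 124"
        by (simp add: powr_mult powr_powr)
      also have "\<dots> = cmod (F 0) powr 128 * ((1 + cmod z) powr 124 / (1 - cmod z) powr 124)"
        using z1 by (subst powr_divide) auto
      finally have "cmod (F z) powr 128 * (1 - cmod z) powr 124 \<le> cmod (F 0) powr 128 * (1 + cmod z) powr 124"
        using z1 by (simp add: pos_le_divide_eq)
      also have "\<dots> \<le> C" unfolding C_def using z by (intro mult_left_mono powr_mono2) auto
      finally show ?thesis .
    qed
    have "(\<integral>\<^sup>+ z\<in>unit_disk. ennreal (cmod (F z) powr 128 * (1 - cmod z) powr 124) \<partial>lborel) \<le>
      (\<integral>\<^sup>+ z\<in>unit_disk. ennreal C \<partial>lborel)"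
    proof (rule nn_integral_mono)
      show "ennreal (cmod (F z) powr 128 * (1 - cmod z) powr 124) * indicator unit_disk z \<le>
        ennreal C * indicator unit_disk z" for z
      proof (cases "z \<in> unit_disk")
        case True
        thus ?thesis using ennreal_leI[OF le[OF True]] by (simp only: indicator_simps mult_1_right)
      next
        case False
        show ?thesis by (simp only: indicator_simps(2)[OF False] mult_zero_right order_refl)
      qed
    qed
    also have "\<dots> = ennreal C * emeasure lborel unit_disk" by (rule nn_integral_cmult_indicator) simp
    also have "\<dots> < \<infinity>" using emeasure_bounded_finite[of unit_disk] by (simp add: ennreal_mult_less_top)
    finally show ?thesis using Hol_holomorphic[OF F] by (simp add: bergman_space_def)
  qed
  hence "ereal (128 / (124 + 2)) \<in> {ereal (p / (\<alpha> + 2)) | p \<alpha>. 0 < p \<and> -1 < \<alpha> \<and> F \<in> bergman_space p \<alpha>} \<union> {0}"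
    by (intro UnI1 CollectI exI[of _ 128] exI[of _ 124]) auto
  from Sup_upper[OF this] show ?thesis by (simp add: bergman_number_def)
qed

text \<open>The image is the sector \<open>pi/8 < Arg w < 3 * pi/8\<close>, which contains no dyadic point.\<close>

lemma ex_sector_map:
  obtains F where "F \<in> Hol punctured_halfplane"
    "\<And>z. z \<in> unit_disk \<Longrightarrow> cmod (F z) = (cmod (1 + z) / cmod (1 - z)) powr (1 / 4)"
proof -
  define T where "T = to_halfplane 1"
  have T: "T \<in> Hol halfplane" unfolding T_def by (rule Hol_to_halfplane) simp
  define F where "F = (\<lambda>z. exp (\<i> * of_real (pi / 4) + Ln (T z) / 4))"
  have nz: "T z \<noteq> 0" "T z \<notin> \<real>\<^sub>\<le>\<^sub>0" if "z \<in> unit_disk" for z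
    using Hol_in[OF T that] by (auto simp: halfplane_def complex_nonpos_Reals_iff)
  have "F \<in> Hol punctured_halfplane"
  proof (rule HolI)
    show "F holomorphic_on unit_disk"
      unfolding F_def using Hol_holomorphic[OF T] nz by (intro holomorphic_intros) auto
    fix z assume z: "z \<in> unit_disk"
    have "\<bar>Im (Ln (T z))\<bar> < pi / 2"
      using Hol_in[OF T z] by (intro Re_Ln_pos_lt_imp) (simp add: halfplane_def)
    hence b: "0 < pi / 4 + Im (Ln (T z)) / 4" "pi / 4 + Im (Ln (T z)) / 4 < pi / 2" by linarith+
    have "0 < cos (pi / 4 + Im (Ln (T z)) / 4)" using b by (intro cos_gt_zero_pi) linarith+
    moreover have "0 < sin (pi / 4 + Im (Ln (T z)) / 4)" using b by (intro sin_gt_zero) linarith+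
    ultimately show "F z \<in> punctured_halfplane"
      by (intro in_punctured_halfplaneI) (auto simp: F_def Re_exp Im_exp)
  qed
  moreover have "cmod (F z) = (cmod (1 + z) / cmod (1 - z)) powr (1 / 4)" if "z \<in> unit_disk" for z
  proof -
    have "cmod (T z) = cmod (1 + z) / cmod (1 - z)" by (simp add: T_def to_halfplane_def norm_divide)
    thus ?thesis using nz[OF that] by (auto simp: F_def powr_def)
  qed
  ultimately show ?thesis by (rule that)
qed

section \<open>Finiteness of the Bergman number and positivity of the Hardy number\<close>

text \<open>One lower bound for both signs of the exponent; the weight \<alpha> below may be
  negative.\<close>

lemma powr_ge_two_powr:
  assumes "1 / 2 \<le> (x::real)" "x \<le> 2"
  shows "2 powr (- \<bar>a\<bar>) \<le> x powr a"
proof (cases "0 \<le> a")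
  case True
  have "2 powr (- \<bar>a\<bar>) = (1 / 2) powr a" using True by (simp add: powr_minus_divide powr_divide)
  also have "\<dots> \<le> x powr a" using assms True by (intro powr_mono2) auto
  finally show ?thesis .
next
  case False
  have "2 powr (- \<bar>a\<bar>) = 2 powr a" using False by simp
  also have "\<dots> \<le> x powr a" using assms False by (intro powr_mono2') auto
  finally show ?thesis .
qed

text \<open>Near the boundary point 1 the map grows like \<open>|1 - z| powr (- 1/4)\<close>. The
  disc of radius \<open>t / 2\<close> about \<open>1 - t\<close> contributes about
  \<open>t powr (\<alpha> + 2 - p / 4)\<close> to the integral, which is unbounded as
  \<open>t\<close> tends to 0 when \<open>p / 4 > \<alpha> + 2\<close>.\<close>

lemma bergman_number_sector_map:
  assumes F: "\<And>z. z \<in> unit_disk \<Longrightarrow> cmod (F z) = (cmod (1 + z) / cmod (1 - z)) powr (1 / 4)"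
    and p: "0 < p" and B: "F \<in> bergman_space p \<alpha>" and \<alpha>: "-1 < \<alpha>"
  shows "p / (\<alpha> + 2) \<le> 4"
proof (rule ccontr)
  assume "\<not> ?thesis"
  hence p4: "4 * (\<alpha> + 2) < p" using \<alpha> by (simp add: field_simps)
  define \<delta> where "\<delta> = p / 4 - (\<alpha> + 2)"
  have \<delta>: "0 < \<delta>" using p4 by (simp add: \<delta>_def)
  define I where "I = (\<integral>\<^sup>+ z\<in>unit_disk. ennreal (cmod (F z) powr p * (1 - cmod z) powr \<alpha>) \<partial>lborel)"
  have "I < \<infinity>" using B by (simp add: bergman_space_def I_def)
  then obtain M where M: "0 \<le> M" "I = ennreal M" by (cases I) auto
  \<comment> \<open>The factors come from \<open>|1 - z| \<le> 3 * t / 2\<close>, from the distance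
    to the circle lying between \<open>t / 2\<close> and \<open>2 * t\<close>, and from the area of
    the small disc.\<close>
  define c where "c = (2 / 3) powr (p / 4) * 2 powr (- \<bar>\<alpha>\<bar>) * (pi / 4)"
  have c: "0 < c" by (simp add: c_def)
  have key: "c * t powr (- \<delta>) \<le> M" if t: "0 < t" "t \<le> 1 / 2" for t
  proof -
    define U where "U = ball (of_real (1 - t) :: complex) (t / 2)"
    define m where "m = (2 / (3 * t)) powr (p / 4) * (t powr \<alpha> * 2 powr (- \<bar>\<alpha>\<bar>))"
    have z: "z \<in> unit_disk" "m \<le> cmod (F z) powr p * (1 - cmod z) powr \<alpha>" if "z \<in> U" for z
    proof -
      have d: "cmod (z - of_real (1 - t)) < t / 2" using that by (simp add: U_def dist_norm norm_minus_commute)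
      have n: "cmod (of_real (1 - t) :: complex) = 1 - t" using t by (simp only: norm_of_real abs_of_nonneg diff_ge_0_iff_ge)
      have "cmod z \<le> 1 - t + t / 2" "1 - t - t / 2 \<le> cmod z"
        using norm_triangle_sub[of z "of_real (1 - t)"] norm_triangle_sub[of "of_real (1 - t)" z] d
        unfolding n by (simp_all add: norm_minus_commute)
      hence b: "t / 2 \<le> 1 - cmod z" "1 - cmod z \<le> 2 * t" using t by auto
      show zd: "z \<in> unit_disk" using b t by simp
      have "(1 - z) = of_real t - (z - of_real (1 - t))" by simp
      hence d1: "cmod (1 - z) \<le> 3 * t / 2"
        using norm_triangle_ineq4[of "of_real t" "z - of_real (1 - t)"] d t by simp
      have "cmod (2 - (1 - z)) \<ge> cmod 2 - cmod (1 - z)" by (rule norm_triangle_ineq2)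
      hence d2: "1 \<le> cmod (1 + z)" using d1 t by simp
      have "0 < cmod (1 - z)" using zd by auto
      hence "2 / (3 * t) \<le> cmod (1 + z) / cmod (1 - z)" using d1 d2 t frac_le[of "cmod (1 + z)" 1 "cmod (1 - z)" "3 * t / 2"] by simp
      hence "(2 / (3 * t)) powr (p / 4) \<le> (cmod (1 + z) / cmod (1 - z)) powr (p / 4)"
        using t p by (intro powr_mono2) auto
      also have "\<dots> = cmod (F z) powr p" by (simp add: F[OF zd] powr_powr)
      finally have 1: "(2 / (3 * t)) powr (p / 4) \<le> cmod (F z) powr p" .
      have "2 powr (- \<bar>\<alpha>\<bar>) \<le> ((1 - cmod z) / t) powr \<alpha>"
        using b t by (intro powr_ge_two_powr) (auto simp: field_simps)
      hence "t powr \<alpha> * 2 powr (- \<bar>\<alpha>\<bar>) \<le> t powr \<alpha> * ((1 - cmod z) / t) powr \<alpha>"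
        by (intro mult_left_mono) auto
      also have "\<dots> = (1 - cmod z) powr \<alpha>" using t b by (simp add: powr_mult[symmetric])
      finally show "m \<le> cmod (F z) powr p * (1 - cmod z) powr \<alpha>"
        unfolding m_def using 1 by (intro mult_mono) auto
    qed
    have "ennreal m * emeasure lborel U = (\<integral>\<^sup>+ z\<in>U. ennreal m \<partial>lborel)"
      by (rule nn_integral_cmult_indicator[symmetric]) (simp add: U_def)
    also have "\<dots> \<le> I"
      unfolding I_def using z by (intro nn_integral_mono) (auto intro!: ennreal_leI simp: indicator_def)
    also have "emeasure lborel U = ennreal (pi * (t / 2)\<^sup>2)"
      unfolding U_def using t by (subst emeasure_ball) (auto simp: unit_ball_vol_2)
    also have "ennreal m * ennreal (pi * (t / 2)\<^sup>2) = ennreal (m * (pi * (t / 2)\<^sup>2))"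
      by (rule ennreal_mult[symmetric]) (auto simp: m_def)
    finally have "m * (pi * (t / 2)\<^sup>2) \<le> M" using M by (simp add: ennreal_le_iff)
    also have "m * (pi * (t / 2)\<^sup>2) = c * t powr (- \<delta>)"
    proof -
      have "(2 / (3 * t)) powr (p / 4) = (2 / 3) powr (p / 4) * t powr (- (p / 4))"
        using t by (simp add: powr_divide powr_mult powr_minus divide_simps)
      moreover have "t powr (- (p / 4)) * t powr \<alpha> * t\<^sup>2 = t powr (- \<delta>)"
      proof -
        have "t powr (- (p / 4)) * t powr \<alpha> * t powr 2 = t powr (- (p / 4) + \<alpha> + 2)" by (simp only: powr_add)
        also have "- (p / 4) + \<alpha> + 2 = - \<delta>" by (simp add: \<delta>_def)
        finally show ?thesis using t by simp
      qed
      ultimately show ?thesis by (simp add: m_def c_def power2_eq_square mult_ac)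
    qed
    finally show ?thesis .
  qed
  \<comment> \<open>Makes \<open>X powr \<delta>\<close> at least \<open>M / c + 1\<close>,
    contradicting the bound at \<open>t = 1 / X\<close>; the maximum with 2 keeps
    \<open>t \<le> 1 / 2\<close>.\<close>
  define X where "X = max 2 ((M / c + 1) powr (1 / \<delta>))"
  define t where "t = 1 / X"
  have X: "2 \<le> X" "0 < X" by (auto simp: X_def)
  have "0 < t" "t \<le> 1 / 2" using X by (auto simp: t_def field_simps)
  from key[OF this] have "c * X powr \<delta> \<le> M" using X by (simp add: t_def powr_minus_divide powr_divide)
  moreover have "M / c + 1 = ((M / c + 1) powr (1 / \<delta>)) powr \<delta>"
    using \<delta> M(1) c by (simp add: powr_powr add_nonneg_nonneg)
  hence "M / c + 1 \<le> X powr \<delta>" using \<delta> by (metis X_def less_imp_le max.cobounded2 powr_ge_zero powr_mono2)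
  hence "c * (M / c + 1) \<le> c * X powr \<delta>" using c by (intro mult_left_mono) auto
  hence "M + c \<le> c * X powr \<delta>" using c by (simp add: algebra_simps)
  ultimately show False using c by linarith
qed

text \<open>The square root of \<open>F\<close> has argument of modulus below \<open>pi / 4\<close>,
  so its modulus is at most twice its real part, whose circle means are constant.\<close>

lemma halfplane_subset_hardy_half: "Hol halfplane \<subseteq> hardy_space (1 / 2)"
proof
  fix F assume F: "F \<in> Hol halfplane"
  obtain k where k: "k holomorphic_on unit_disk"
    "\<And>z. z \<in> unit_disk \<Longrightarrow> Re (k z) = cmod (F z) powr (1 / 2) * cos (1 / 2 * Arg (F z))"
    by (rule Hol_halfplane_powr[OF F, of "1 / 2"]) blast
  have le: "cmod (F z) powr (1 / 2) \<le> Re (2 * k z)" if z: "z \<in> unit_disk" for z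
  proof -
    have nz: "0 < Re (F z)" "F z \<noteq> 0" using Hol_in[OF F z] by (auto simp: halfplane_def)
    have "\<bar>Arg (F z)\<bar> < pi / 2" unfolding Arg_eq_Im_Ln[OF nz(2)] by (rule Re_Ln_pos_lt_imp[OF nz(1)])
    \<comment> \<open>The angle is even below \<open>pi / 4\<close>; \<open>pi / 3\<close> is used
      because its cosine is the rational 1/2.\<close>
    hence "cos (pi / 3) \<le> cos \<bar>1 / 2 * Arg (F z)\<bar>" by (intro cos_monotone_0_pi_le) auto
    hence "1 / 2 \<le> cos (1 / 2 * Arg (F z))" by (simp only: cos_60 cos_abs_real)
    from mult_left_mono[OF this, of "cmod (F z) powr (1 / 2)"] show ?thesis by (simp add: k(2)[OF z])
  qed
  show "F \<in> hardy_space (1 / 2)"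
  proof (rule hardy_spaceI[OF Hol_holomorphic[OF F]])
    fix r :: real assume r: "0 < r" "r < 1"
    have hol: "(\<lambda>z. 2 * k z) holomorphic_on unit_disk" by (intro holomorphic_intros k)
    have "circle_mean (\<lambda>z. cmod (F z) powr (1 / 2)) r \<le> circle_mean (\<lambda>z. Re (2 * k z)) r"
      using r le by (intro circle_mean_mono continuous_on_norm_powr continuous_on_Re
          continuous_on_circle_sphere[OF hol] continuous_on_circle_sphere[OF Hol_holomorphic[OF F]]) auto
    also have "\<dots> = Re (2 * k 0)" by (rule mean_value_circle[OF hol r])
    finally show "circle_mean (\<lambda>z. cmod (F z) powr (1 / 2)) r \<le> Re (2 * k 0)" .
  qed simp
qed

theorem theorem1p1:
  shows "\<exists>D. complex_domain D \<and>
    0 < hardy_number_domain D \<and>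
    hardy_number_domain D < bergman_number_domain D \<and>
    bergman_number_domain D < \<infinity>"
proof (intro exI conjI)
  let ?D = punctured_halfplane
  show "complex_domain ?D" by (rule complex_domain_punctured_halfplane)
  have "Hol ?D \<subseteq> hardy_space (1 / 2)"
    using halfplane_subset_hardy_half Hol_mono[OF _ punctured_halfplane_subset] by blast
  hence "ereal (1 / 2) \<in> {ereal p | p. 0 < p \<and> Hol ?D \<subseteq> hardy_space p} \<union> {0}"
    by (intro UnI1 CollectI exI[of _ "1 / 2"]) auto
  from Sup_upper[OF this] have "ereal (1 / 2) \<le> hardy_number_domain ?D"
    by (simp only: hardy_number_domain_def)
  thus "0 < hardy_number_domain ?D" by (rule less_le_trans[rotated]) simp
  have "p \<le> 1" if "Hol ?D \<subseteq> hardy_space p" for p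
    using punctured_halfplane_not_hardy[of p] that by linarith
  hence "hardy_number_domain ?D \<le> ereal 1"
    unfolding hardy_number_domain_def by (intro Sup_least) auto
  also have "\<dots> < ereal (64 / 63)" by simp
  also have "\<dots> \<le> bergman_number_domain ?D"
    unfolding bergman_number_domain_def
    by (intro Inf_greatest) (use bergman_number_ge_punctured_halfplane in blast)
  finally show "hardy_number_domain ?D < bergman_number_domain ?D" .
  obtain F where F: "F \<in> Hol ?D"
    "\<And>z. z \<in> unit_disk \<Longrightarrow> cmod (F z) = (cmod (1 + z) / cmod (1 - z)) powr (1 / 4)"
    by (rule ex_sector_map) blast
  have "bergman_number_domain ?D \<le> bergman_number F"
    unfolding bergman_number_domain_def by (rule Inf_lower) (use F(1) in blast)
  also have "\<dots> \<le> ereal 4"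
    unfolding bergman_number_def
    by (rule Sup_least) (use bergman_number_sector_map[OF F(2)] in auto)
  also have "\<dots> < \<infinity>" by simp
  finally show "bergman_number_domain ?D < \<infinity>" .
qed

end
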